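(* Dominating Set can be solved in time $O(3^k\cdot n^{O(1)})$ and polynomial space on $n$-vertex graphs $G$ given together with a multiple interval representation $f$ of $G$ satisfying $\sum_{v\in V}|f(v)|\le n+k$.
   Context: A multiple interval representation $f$ of a graph $G=(V,E)$ assigns to each vertex $v$ a nonempty finite collection $f(v)$ of intervals of the real line such that distinct $u,v$ are adjacent iff some interval of $f(u)$ intersects some interval of $f(v)$. A dominating set is a set $D\subseteq V$ such that every vertex of $V\setminus D$ has a neighbor in $D$. Dominating Set: given $G$ and a positive integer $p$, decide whether $G$ has a dominating set of size $p$. *)

theory Defs
  imports "HOL-Analysis.Analysis" "HOL-Library.Multiset" "HOL-Library.Discrete_Functions"
begin

section \<open>Graphs, dominating sets and multiple interval representations\<close>

text \<open>An \<open>n\<close>-vertex graph has vertex set \<open>{..<n}\<close>; edges are two-element sets of vertices.\<close>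

definition simple_graph :: "nat set \<Rightarrow> nat set set \<Rightarrow> bool" where
  "simple_graph V E \<longleftrightarrow> finite V \<and> (\<forall>e\<in>E. e \<subseteq> V \<and> card e = 2)"

definition dominating_set :: "nat set \<Rightarrow> nat set set \<Rightarrow> nat set \<Rightarrow> bool" where
  "dominating_set V E D \<longleftrightarrow> D \<subseteq> V \<and> (\<forall>v\<in>V - D. \<exists>u\<in>D. {u, v} \<in> E)"

text \<open>
  Intervals may be open, closed, half-open, unbounded or a single point, but not empty.  The
  collection \<open>f v\<close> is a multiset, so that \<open>size (f v)\<close> is the number of its intervals.
\<close>

definition multiple_interval_rep ::
    "nat set \<Rightarrow> nat set set \<Rightarrow> (nat \<Rightarrow> real set multiset) \<Rightarrow> bool" where
  "multiple_interval_rep V E f \<longleftrightarrow>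
     (\<forall>v\<in>V. f v \<noteq> {#} \<and> (\<forall>I\<in>#f v. is_interval I \<and> I \<noteq> {})) \<and>
     (\<forall>u\<in>V. \<forall>v\<in>V. u \<noteq> v \<longrightarrow>
        ({u, v} \<in> E \<longleftrightarrow> (\<exists>I\<in>#f u. \<exists>J\<in>#f v. I \<inter> J \<noteq> {})))"


section \<open>Random access machines\<close>

text \<open>
  Structured programs for a random access machine over the natural numbers.  The memory consists
  of arrays whose names are constants of the program; a scalar variable is cell \<open>0\<close> of
  an array.  Arithmetic is addition and truncated subtraction.
\<close>

type_synonym state = "nat \<Rightarrow> nat \<Rightarrow> nat"

datatype expr =
    Const nat
  | Cell nat expr
  | Plus expr expr
  | Minus expr expr

fun eval_expr :: "expr \<Rightarrow> state \<Rightarrow> nat" where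
  "eval_expr (Const c) s = c"
| "eval_expr (Cell a e) s = s a (eval_expr e s)"
| "eval_expr (Plus e1 e2) s = eval_expr e1 s + eval_expr e2 s"
| "eval_expr (Minus e1 e2) s = eval_expr e1 s - eval_expr e2 s"

fun expr_cost :: "expr \<Rightarrow> nat" where
  "expr_cost (Const c) = 1"
| "expr_cost (Cell a e) = 1 + expr_cost e"
| "expr_cost (Plus e1 e2) = 1 + expr_cost e1 + expr_cost e2"
| "expr_cost (Minus e1 e2) = 1 + expr_cost e1 + expr_cost e2"

datatype prog =
    Skip
  | Assign nat expr expr
  | Seq prog prog
  | If expr prog prog
  | While expr prog

definition update :: "state \<Rightarrow> nat \<Rightarrow> nat \<Rightarrow> nat \<Rightarrow> state" where
  "update s a i x = s(a := (s a)(i := x))"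

definition bit_length :: "nat \<Rightarrow> nat" where
  "bit_length x = floor_log x + 1"

text \<open>
  The space of a memory state is counted in bits and includes the addresses of the cells.
  Only finitely many cells are nonzero in every state that a run starting from an input
  reaches (see \<open>exec_finite_support\<close> and \<open>finite_support_initial_state\<close>).
\<close>

definition support :: "state \<Rightarrow> (nat \<times> nat) set" where
  "support s = {(a, i). s a i \<noteq> 0}"

definition state_bits :: "state \<Rightarrow> nat" where
  "state_bits s = (\<Sum>(a, i)\<in>support s. bit_length a + bit_length i + bit_length (s a i))"

text \<open>
  \<open>exec c s t m s'\<close>: started in \<open>s\<close>, the program \<open>c\<close> terminates in \<open>s'\<close> after \<open>t\<close> elementary
  operations, and \<open>m\<close> is the largest number of bits held in memory during the run.  Elementary
  operations have unit cost; as \<open>m\<close> counts bits, a run uses \<open>t\<close> operations on numbers of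
  \<open>O(m)\<close> bits each.  Tests are true if the value is nonzero.
\<close>

inductive exec :: "prog \<Rightarrow> state \<Rightarrow> nat \<Rightarrow> nat \<Rightarrow> state \<Rightarrow> bool" where
  Skip: "exec Skip s 1 (state_bits s) s"
| Assign:
    "s' = update s a (eval_expr e1 s) (eval_expr e2 s) \<Longrightarrow>
     exec (Assign a e1 e2) s (1 + expr_cost e1 + expr_cost e2)
       (max (state_bits s) (state_bits s')) s'"
| Seq:
    "exec c1 s t1 m1 s' \<Longrightarrow> exec c2 s' t2 m2 s'' \<Longrightarrow>
     exec (Seq c1 c2) s (t1 + t2) (max m1 m2) s''"
| IfTrue:
    "eval_expr e s \<noteq> 0 \<Longrightarrow> exec c1 s t m s' \<Longrightarrow>
     exec (If e c1 c2) s (1 + expr_cost e + t) m s'"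
| IfFalse:
    "eval_expr e s = 0 \<Longrightarrow> exec c2 s t m s' \<Longrightarrow>
     exec (If e c1 c2) s (1 + expr_cost e + t) m s'"
| WhileFalse:
    "eval_expr e s = 0 \<Longrightarrow> exec (While e c) s (1 + expr_cost e) (state_bits s) s"
| WhileTrue:
    "eval_expr e s \<noteq> 0 \<Longrightarrow> exec c s t1 m1 s' \<Longrightarrow> exec (While e c) s' t2 m2 s'' \<Longrightarrow>
     exec (While e c) s (1 + expr_cost e + t1 + t2) (max m1 m2) s''"

inductive_cases exec_SkipE: "exec Skip s t m s'"
inductive_cases exec_AssignE: "exec (Assign a e1 e2) s t m s'"
inductive_cases exec_SeqE: "exec (Seq c1 c2) s t m s'"
inductive_cases exec_IfE: "exec (If e c1 c2) s t m s'"
inductive_cases exec_WhileE: "exec (While e c) s t m s'"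

definition initial_state :: "nat list \<Rightarrow> state" where
  "initial_state xs = (\<lambda>a i. if a = 0 \<and> i < length xs then xs ! i else 0)"

definition accepting :: "state \<Rightarrow> bool" where
  "accepting s \<longleftrightarrow> s 1 0 \<noteq> 0"

definition input_bits :: "nat list \<Rightarrow> nat" where
  "input_bits xs = (\<Sum>x\<leftarrow>xs. bit_length x)"

lemma exec_deterministic:
  "exec c s t m s' \<Longrightarrow> exec c s t2 m2 s2 \<Longrightarrow> t2 = t \<and> m2 = m \<and> s2 = s'"
proof (induction arbitrary: t2 m2 s2 rule: exec.induct)
  case (Skip s)
  then show ?case by (auto elim: exec_SkipE)
next
  case (Assign s' s a e1 e2)
  then show ?case by (auto elim: exec_AssignE)
next
  case (Seq c1 s t1 m1 s' c2 t2 m2 s'')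
  from Seq.prems show ?case by (rule exec_SeqE) (use Seq.IH in blast)
next
  case (IfTrue e s c1 t m s' c2)
  from IfTrue.prems obtain t' where "exec c1 s t' m2 s2" "t2 = 1 + expr_cost e + t'"
    using IfTrue.hyps(1) by (auto elim: exec_IfE)
  then show ?case using IfTrue.IH[of t' m2 s2] by simp
next
  case (IfFalse e s c2 t m s' c1)
  from IfFalse.prems obtain t' where "exec c2 s t' m2 s2" "t2 = 1 + expr_cost e + t'"
    using IfFalse.hyps(1) by (auto elim: exec_IfE)
  then show ?case using IfFalse.IH[of t' m2 s2] by simp
next
  case (WhileFalse e s c)
  then show ?case by (auto elim: exec_WhileE)
next
  case (WhileTrue e s c t1 m1 s' t1' m1' s'')
  from WhileTrue.prems obtain u1 n1 v u2 n2 where "exec c s u1 n1 v" "exec (While e c) v u2 n2 s2"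
    "t2 = 1 + expr_cost e + u1 + u2" "m2 = max n1 n2"
    using WhileTrue.hyps(1) by (auto elim: exec_WhileE)
  then show ?case using WhileTrue.IH(1)[of u1 n1 v] WhileTrue.IH(2)[of u2 n2 s2] by simp
qed

lemma finite_support_initial_state: "finite (support (initial_state xs))"
proof -
  have "support (initial_state xs) \<subseteq> {0} \<times> {..<length xs}"
    by (auto simp: support_def initial_state_def split: if_splits)
  then show ?thesis by (rule finite_subset) simp
qed

lemma exec_finite_support: "exec c s t m s' \<Longrightarrow> finite (support s) \<Longrightarrow> finite (support s')"
proof (induction rule: exec.induct)
  case (Assign s' s a e1 e2)
  have "support s' \<subseteq> insert (a, eval_expr e1 s) (support s)"
    by (auto simp: Assign support_def update_def split: if_splits)
  then show ?case using Assign by (meson finite_insert finite_subset)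
qed auto


section \<open>Encoding of instances\<close>

text \<open>
  The intervals of a representation are given as a list of triples (owner, left, right).  The
  numbers \<open>left \<le> right\<close> describe the position of an interval relative to the others: one
  interval lies entirely to the left of another iff its right number is smaller than the left
  number of the other.  This covers closed intervals given by natural endpoints, as well as
  real intervals whose endpoints are given by their ranks in the sorted order of all endpoints.
  Every representation has such an encoding (\<open>ex_encodes_rep\<close>).
\<close>

definition left_of :: "real set \<Rightarrow> real set \<Rightarrow> bool" where
  "left_of I J \<longleftrightarrow> (\<forall>x\<in>I. \<forall>y\<in>J. x < y)"

definition encodes_rep ::
    "nat \<Rightarrow> (nat \<Rightarrow> real set multiset) \<Rightarrow> (nat \<times> nat \<times> nat) list \<Rightarrow> bool" where
  "encodes_rep n f ts \<longleftrightarrow>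
     (\<exists>Is :: real set list. length Is = length ts \<and>
        (\<forall>(v, l, r)\<in>set ts. v < n \<and> l \<le> r) \<and>
        (\<forall>v<n. f v = mset (map snd (filter (\<lambda>(t, I). fst t = v) (zip ts Is)))) \<and>
        (\<forall>i<length ts. \<forall>j<length ts.
           snd (snd (ts ! i)) < fst (snd (ts ! j)) \<longleftrightarrow> left_of (Is ! i) (Is ! j)))"

definition adjacency_matrix :: "nat \<Rightarrow> nat set set \<Rightarrow> nat list" where
  "adjacency_matrix n E =
     concat (map (\<lambda>u. map (\<lambda>v. of_bool ({u, v} \<in> E)) [0..<n]) [0..<n])"

definition encodes_instance ::
    "nat \<Rightarrow> nat set set \<Rightarrow> (nat \<Rightarrow> real set multiset) \<Rightarrow> nat \<Rightarrow> nat list \<Rightarrow> bool" where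
  "encodes_instance n E f p xs \<longleftrightarrow>
     (\<exists>ts. encodes_rep n f ts \<and>
        xs = [n, p, length ts] @ concat (map (\<lambda>(v, l, r). [v, l, r]) ts) @ adjacency_matrix n E)"

lemma ex_owner_list:
  fixes f :: "nat \<Rightarrow> 'b multiset"
  shows "\<exists>xs. (\<forall>x\<in>set xs. fst x < n) \<and>
           (\<forall>v<n. f v = mset (map snd (filter (\<lambda>x. fst x = v) xs)))"
proof (induction n)
  case 0
  show ?case by (rule exI[of _ "[]"]) simp
next
  case (Suc n)
  then obtain xs where xs: "\<forall>x\<in>set xs. fst x < n"
    "\<forall>v<n. f v = mset (map snd (filter (\<lambda>x. fst x = v) xs))" by blast
  obtain ys where ys: "mset ys = f n" using ex_mset by blast
  have old: "filter (\<lambda>x. fst x = n) xs = []" using xs(1) by (auto simp: filter_empty_conv)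
  have new: "filter (\<lambda>x. fst x = v) (map (Pair n) ys) = (if v = n then map (Pair n) ys else [])"
    for v by (induction ys) auto
  have "f v = mset (map snd (filter (\<lambda>x. fst x = v) (xs @ map (Pair n) ys)))" if "v < Suc n" for v
    using that xs(2) old new[of v] ys by (cases "v = n") (auto simp: comp_def)
  moreover have "\<forall>x\<in>set (xs @ map (Pair n) ys). fst x < Suc n" using xs(1) by auto
  ultimately show ?case by blast
qed

lemma ex_encodes_rep:
  assumes "multiple_interval_rep {..<n} E f"
  shows "\<exists>ts. encodes_rep n f ts"
proof -
  obtain xs where own: "\<forall>x\<in>set xs. fst x < n"
    and fxs: "\<forall>v<n. f v = mset (map snd (filter (\<lambda>x. fst x = v) xs))"
    using ex_owner_list by blast
  define m where "m = length xs"
  define J where "J j = snd (xs ! j)" for j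
  have ne: "J j \<noteq> {}" if "j < m" for j
  proof -
    have v: "fst (xs ! j) < n" using own that by (auto simp: m_def)
    have "xs ! j \<in> set (filter (\<lambda>x. fst x = fst (xs ! j)) xs)" using that by (simp add: m_def)
    then have "J j \<in># f (fst (xs ! j))" using fxs v by (simp add: J_def)
    then show ?thesis using assms v by (auto simp: multiple_interval_rep_def)
  qed
  define P where "P j = {i. i < m \<and> left_of (J i) (J j)}" for j
  have fin: "finite (P j)" for j by (simp add: P_def)
  have nested: "P j \<subseteq> P j' \<or> P j' \<subseteq> P j" if "j < m" "j' < m" for j j'
  proof (rule ccontr)
    assume "\<not> ?thesis"
    then obtain a b where ab: "a < m" "b < m" "left_of (J a) (J j)" "\<not> left_of (J a) (J j')"
      "left_of (J b) (J j')" "\<not> left_of (J b) (J j)" by (auto simp: P_def)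
    then obtain x y x' y' where "x \<in> J a" "y \<in> J j'" "y \<le> x" "x' \<in> J b" "y' \<in> J j" "y' \<le> x'"
      by (auto simp: left_of_def not_less)
    with ab show False by (fastforce simp: left_of_def)
  qed
  define L where "L j = card (P j)" for j
  define A where "A i = {L j |j. j < m \<and> i \<in> P j}" for i
  define R where "R i = (if A i = {} then m else Min (A i) - 1)" for i
  have finA: "finite (A i)" for i by (simp add: A_def)
  have Lm: "L j \<le> m" for j
    using card_mono[of "{..<m}" "P j"] by (auto simp: L_def P_def)
  have key: "R i < L j \<longleftrightarrow> left_of (J i) (J j)" if "i < m" "j < m" for i j
  proof
    assume lt: "R i < L j"
    then have "A i \<noteq> {}" using Lm[of j] by (auto simp: R_def)
    then have "Min (A i) \<in> A i" using finA by (simp add: Min_in)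
    then obtain j' where j': "j' < m" "i \<in> P j'" "Min (A i) = L j'" by (auto simp: A_def)
    have "L j' \<le> L j" using lt j'(3) \<open>A i \<noteq> {}\<close> by (simp add: R_def)
    then have "P j' \<subseteq> P j"
      using nested[OF j'(1) that(2)] card_subset_eq[OF fin, of "P j" j'] card_mono[OF fin, of "P j" j']
      by (auto simp: L_def)
    then show "left_of (J i) (J j)" using j'(2) by (auto simp: P_def)
  next
    assume "left_of (J i) (J j)"
    then have ij: "i \<in> P j" using that by (simp add: P_def)
    then have mem: "L j \<in> A i" using that by (auto simp: A_def)
    then have "Min (A i) \<le> L j" using finA by simp
    moreover have "0 < L j" using ij fin by (auto simp: L_def card_gt_0_iff)
    ultimately show "R i < L j" using mem by (auto simp: R_def)
  qed
  have LR: "L i \<le> R i" if "i < m" for i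
    using key[OF that that] ne[OF that] by (fastforce simp: left_of_def not_less)
  define ts where "ts = map (\<lambda>j. (fst (xs ! j), L j, R j)) [0..<m]"
  have "zip ts (map snd xs) = map (\<lambda>j. ((fst (xs ! j), L j, R j), J j)) [0..<m]"
    by (rule nth_equalityI) (auto simp: ts_def m_def J_def)
  moreover have "map snd (filter (\<lambda>x. fst x = v) xs) =
      map snd (filter (\<lambda>x. fst x = v) (map (\<lambda>j. xs ! j) [0..<m]))" for v
    unfolding m_def map_nth ..
  ultimately have "f v = mset (map snd (filter (\<lambda>(t, I). fst t = v) (zip ts (map snd xs))))"
    if "v < n" for v
    using fxs that by (simp add: filter_map comp_def J_def)
  moreover have "\<forall>(v, l, r)\<in>set ts. v < n \<and> l \<le> r"
    using own LR by (auto simp: ts_def m_def)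
  moreover have "\<forall>i<length ts. \<forall>j<length ts.
      snd (snd (ts ! i)) < fst (snd (ts ! j)) \<longleftrightarrow> left_of (map snd xs ! i) (map snd xs ! j)"
    using key by (auto simp: ts_def m_def J_def)
  ultimately have "encodes_rep n f ts"
    unfolding encodes_rep_def by (intro exI[of _ "map snd xs"]) (auto simp: ts_def m_def)
  then show ?thesis ..
qed

end

theory Submission
  imports Defs "HOL-Real_Asymp.Real_Asymp"
begin

text \<open>
  For every vertex \<open>v\<close> with \<open>j \<ge> 2\<close> intervals guess whether \<open>v\<close> is in the solution or, if not,
  which of its intervals meets an interval of the solution: \<open>j + 1 \<le> 3 ^ (j - 1)\<close> choices, hence
  at most \<open>3 ^ k\<close> guesses in total.  What remains is to hit a set of target intervals with as few
  intervals of the other vertices, which have one interval each, as possible.  This is solved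
  greedily: among the intervals that meet the missed target with the smallest right end, take
  one with the largest right end.  The guesses are enumerated by a mixed-radix counter, so only
  the current guess is stored.
\<close>

section \<open>Weakest preconditions with time and space bounds\<close>

text \<open>Each guess is checked in time polynomial in the number \<open>N\<close> of intervals,
  but the bound to be proved allows only powers of \<open>n\<close>, and \<open>N\<close> exceeds
  every polynomial in \<open>n\<close> when \<open>k\<close> is large. The slack between
  \<open>j + 1\<close> and \<open>3 ^ (j - 1)\<close> has to absorb a power of \<open>N\<close>; one
  vertex with the most intervals suffices, since it has at least \<open>N / n\<close> of them.

  A vertex with several intervals hits targets in distant places at the price of one, which defeats
  any sweep along the line. Once these vertices are decided, each candidate is one interval with its
  own price. The greedy rule is then optimal: every missed target ends no earlier than the selected
  one, so among the candidates meeting the selected one a larger right end hits at least as many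
  missed targets.

  Time and space are certified for an explicit program. Every loop except the enumeration makes at
  most \<open>N\<close> rounds, so its time can be read off the syntax; the rounds of the
  enumeration are counted separately. Space follows from an invariant that confines the nonzero
  cells and their values.\<close>

lemma update_same [simp]: "update s a i x a = (s a)(i := x)"
  by (simp add: update_def)

lemma update_other [simp]: "b \<noteq> a \<Longrightarrow> update s a i x b = s b"
  by (simp add: update_def)

fun writes :: "prog \<Rightarrow> nat set" where
  "writes Skip = {}"
| "writes (Assign a e1 e2) = {a}"
| "writes (Seq c1 c2) = writes c1 \<union> writes c2"
| "writes (If e c1 c2) = writes c1 \<union> writes c2"
| "writes (While e c) = writes c"

definition agree :: "nat set \<Rightarrow> state \<Rightarrow> state \<Rightarrow> bool" where
  "agree X s s' \<longleftrightarrow> (\<forall>a. a \<notin> X \<longrightarrow> s' a = s a)"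

lemma agreeD: "agree X s s' \<Longrightarrow> a \<notin> X \<Longrightarrow> s' a = s a"
  by (simp add: agree_def)

lemma exec_agree: "exec c s t m s' \<Longrightarrow> agree (writes c) s s'"
  by (induction rule: exec.induct) (auto simp: agree_def)

text \<open>The number of operations, provided that every loop makes at most \<open>Z\<close> rounds.\<close>

fun time_bound :: "nat \<Rightarrow> prog \<Rightarrow> nat" where
  "time_bound Z Skip = 1"
| "time_bound Z (Assign a e1 e2) = 1 + expr_cost e1 + expr_cost e2"
| "time_bound Z (Seq c1 c2) = time_bound Z c1 + time_bound Z c2"
| "time_bound Z (If e c1 c2) = 1 + expr_cost e + time_bound Z c1 + time_bound Z c2"
| "time_bound Z (While e c) = (Z + 1) * (1 + expr_cost e + time_bound Z c)"

lemma poly_bound_add: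
  fixes f g :: "nat \<Rightarrow> nat"
  assumes "\<exists>C d. \<forall>Z. f Z \<le> C * (Z + 1) ^ d" and "\<exists>C d. \<forall>Z. g Z \<le> C * (Z + 1) ^ d"
  shows "\<exists>C d. \<forall>Z. f Z + g Z \<le> C * (Z + 1) ^ d"
proof -
  obtain C d C' d' where f: "\<And>Z. f Z \<le> C * (Z + 1) ^ d" and g: "\<And>Z. g Z \<le> C' * (Z + 1) ^ d'"
    using assms by blast
  have "f Z + g Z \<le> (C + C') * (Z + 1) ^ (d + d')" for Z
  proof -
    have "(Z + 1) ^ d \<le> (Z + 1) ^ (d + d')" "(Z + 1) ^ d' \<le> (Z + 1) ^ (d + d')"
      by (intro power_increasing; simp)+
    then have "C * (Z + 1) ^ d + C' * (Z + 1) ^ d' \<le> (C + C') * (Z + 1) ^ (d + d')"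
      unfolding add_mult_distrib by (intro add_mono mult_le_mono2)
    then show ?thesis using f[of Z] g[of Z] by linarith
  qed
  then show ?thesis by blast
qed

lemma poly_bound_const: "\<exists>C d. \<forall>Z. (c :: nat) \<le> C * (Z + 1) ^ d"
  by (rule exI[of _ c], rule exI[of _ 0]) simp

text \<open>Each loop contributes one factor \<open>Z + 1\<close>, so for a fixed program the bound
  is a polynomial in \<open>Z\<close> whose degree depends on the program alone.\<close>

lemma time_bound_poly: "\<exists>C d. \<forall>Z. time_bound Z c \<le> C * (Z + 1) ^ d"
proof (induction c)
  case (Seq c1 c2)
  then show ?case using poly_bound_add[OF Seq.IH] by simp
next
  case (If e c1 c2)
  show ?case
    using poly_bound_add[OF poly_bound_add[OF poly_bound_const[of "1 + expr_cost e"] If.IH(1)] If.IH(2)]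
    by (simp add: add.assoc)
next
  case (While e c)
  obtain C d where "\<And>Z. 1 + expr_cost e + time_bound Z c \<le> C * (Z + 1) ^ d"
    using poly_bound_add[OF poly_bound_const[of "1 + expr_cost e"] While.IH] by blast
  then have "time_bound Z (While e c) \<le> C * (Z + 1) ^ Suc d" for Z
    using mult_le_mono2[of "1 + expr_cost e + time_bound Z c" "C * (Z + 1) ^ d" "Z + 1"]
    by (simp add: algebra_simps)
  then show ?case by blast
qed (auto simp only: time_bound.simps poly_bound_const)

definition For :: "nat \<Rightarrow> expr \<Rightarrow> prog \<Rightarrow> prog" where
  "For i e c = Seq (Assign i (Const 0) (Const 0))
     (While (Minus e (Cell i (Const 0)))
        (Seq c (Assign i (Const 0) (Plus (Cell i (Const 0)) (Const 1)))))"

lemma writes_For [simp]: "writes (For i e c) = insert i (writes c)"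
  by (auto simp: For_def)

text \<open>\<open>G\<close> is re-established after every assignment, so the bound \<open>M\<close>
  on the bits of a state in \<open>G\<close> bounds the space of the whole run. \<open>G\<close> can
  also carry facts that never change, such as the contents of the input.\<close>

locale bounded_run =
  fixes G :: "state \<Rightarrow> bool" and M Z :: nat
  assumes space: "G s \<Longrightarrow> state_bits s \<le> M"
begin

definition wp :: "prog \<Rightarrow> (state \<Rightarrow> bool) \<Rightarrow> state \<Rightarrow> bool" where
  "wp c Q s \<longleftrightarrow>
     (\<exists>t m s'. exec c s t m s' \<and> t \<le> time_bound Z c \<and> m \<le> M \<and> G s' \<and> Q s')"

text \<open>Contains the frame rule: \<open>agree\<close> hands over that arrays not written by
  \<open>c\<close> are unchanged, so postconditions need to speak only of what \<open>c\<close>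
  computes.\<close>

lemma wp_conseq:
  assumes "wp c Q s" and "\<And>s'. G s' \<Longrightarrow> agree (writes c) s s' \<Longrightarrow> Q s' \<Longrightarrow> Q' s'"
  shows "wp c Q' s"
  using assms exec_agree unfolding wp_def by blast

lemma wp_Skip: "G s \<Longrightarrow> Q s \<Longrightarrow> wp Skip Q s"
  unfolding wp_def using exec.Skip space by fastforce

lemma wp_Assign:
  assumes "G s" and "s' = update s a (eval_expr e1 s) (eval_expr e2 s)" and "G s'" and "Q s'"
  shows "wp (Assign a e1 e2) Q s"
  unfolding wp_def using exec.Assign[OF assms(2)] assms space[of s] space[of s'] by fastforce

lemma wp_Seq:
  assumes "wp c1 (wp c2 Q) s" shows "wp (Seq c1 c2) Q s"
proof -
  obtain t m s' t' m' s'' where "exec c1 s t m s'" "t \<le> time_bound Z c1" "m \<le> M"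
    "exec c2 s' t' m' s''" "t' \<le> time_bound Z c2" "m' \<le> M" "G s''" "Q s''"
    using assms unfolding wp_def by blast
  then show ?thesis unfolding wp_def
    by (intro exI[of _ "t + t'"] exI[of _ "max m m'"] exI[of _ s'']) (auto intro: exec.Seq)
qed

lemma wp_If:
  assumes "eval_expr e s \<noteq> 0 \<Longrightarrow> wp c1 Q s" and "eval_expr e s = 0 \<Longrightarrow> wp c2 Q s"
  shows "wp (If e c1 c2) Q s"
proof (cases "eval_expr e s = 0")
  case True
  then obtain t m s' where "exec c2 s t m s'" "t \<le> time_bound Z c2" "m \<le> M" "G s'" "Q s'"
    using assms(2) unfolding wp_def by blast
  then show ?thesis using exec.IfFalse[OF True, of c2 t m s' c1] unfolding wp_def by fastforce
next
  case False
  then obtain t m s' where "exec c1 s t m s'" "t \<le> time_bound Z c1" "m \<le> M" "G s'" "Q s'"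
    using assms(1) unfolding wp_def by blast
  then show ?thesis using exec.IfTrue[OF False, of c1 t m s' c2] unfolding wp_def by fastforce
qed

text \<open>The invariant is indexed by the round, and exactly \<open>K - k\<close> rounds remain.
  \<open>K\<close> is independent of \<open>Z\<close>, so the rule serves both the
  \<open>For\<close> loops and the enumeration with its exponentially many rounds.\<close>

lemma exec_While_count:
  assumes body: "\<And>k s. k < K \<Longrightarrow> G s \<Longrightarrow> Inv k s \<Longrightarrow> eval_expr e s \<noteq> 0 \<and> wp c (Inv (Suc k)) s"
    and final: "\<And>s. G s \<Longrightarrow> Inv K s \<Longrightarrow> eval_expr e s = 0"
    and "k \<le> K" and "G s" and "Inv k s"
  shows "\<exists>t m s'. exec (While e c) s t m s' \<and>
    t \<le> (K - k) * (1 + expr_cost e + time_bound Z c) + (1 + expr_cost e) \<and> m \<le> M \<and> G s' \<and> Inv K s'"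
  using assms(3-5)
proof (induction "K - k" arbitrary: k s)
  case 0
  then have "k = K" by simp
  then show ?case using 0 final[of s] exec.WhileFalse[of e s c] space[of s] by fastforce
next
  case (Suc j)
  then have "k < K" by simp
  then obtain t m s' where s': "eval_expr e s \<noteq> 0" "exec c s t m s'" "t \<le> time_bound Z c"
    "m \<le> M" "G s'" "Inv (Suc k) s'"
    using body[of k s] Suc.prems unfolding wp_def by blast
  have "j = K - Suc k" using Suc.hyps(2) by simp
  then obtain t' m' s'' where s'': "exec (While e c) s' t' m' s''"
    "t' \<le> j * (1 + expr_cost e + time_bound Z c) + (1 + expr_cost e)"
    "m' \<le> M" "G s''" "Inv K s''"
    using Suc.hyps(1)[of "Suc k" s'] s'(5,6) \<open>k < K\<close> by auto
  have "1 + expr_cost e + t + t' \<le> (K - k) * (1 + expr_cost e + time_bound Z c) + (1 + expr_cost e)"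
    using s'(3) s''(2) Suc.hyps(2)[symmetric] by simp
  then show ?case using exec.WhileTrue[OF s'(1,2) s''(1)] s'(4) s''(3-5) by fastforce
qed

text \<open>The invariant is demanded with the counter already advanced, and each round may use
  \<open>agree\<close> with the state before the loop; values that the loop does not write thus stay
  out of the invariant.\<close>

lemma wp_For:
  assumes "G s" and "b \<le> Z" and "i \<notin> writes c"
    and upd: "\<And>s x. G s \<Longrightarrow> x \<le> b \<Longrightarrow> G (update s i 0 x)"
    and bound: "\<And>s. G s \<Longrightarrow> eval_expr e s = b"
    and init: "Inv 0 (update s i 0 0)"
    and step: "\<And>k s'. k < b \<Longrightarrow> G s' \<Longrightarrow> s' i 0 = k \<Longrightarrow> agree (insert i (writes c)) s s' \<Longrightarrow>
      Inv k s' \<Longrightarrow> wp c (\<lambda>s''. Inv (Suc k) (update s'' i 0 (Suc k))) s'"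
    and post: "\<And>s'. G s' \<Longrightarrow> agree (insert i (writes c)) s s' \<Longrightarrow> Inv b s' \<Longrightarrow> Q s'"
  shows "wp (For i e c) Q s"
proof -
  let ?J = "\<lambda>k s'. s' i 0 = k \<and> agree (insert i (writes c)) s s' \<and> Inv k s'"
  let ?t = "Minus e (Cell i (Const 0))"
  let ?c = "Seq c (Assign i (Const 0) (Plus (Cell i (Const 0)) (Const 1)))"
  let ?s = "update s i 0 0"
  have "\<exists>t m s'. exec (While ?t ?c) ?s t m s' \<and>
    t \<le> (b - 0) * (1 + expr_cost ?t + time_bound Z ?c) + (1 + expr_cost ?t) \<and> m \<le> M \<and> G s' \<and> ?J b s'"
  proof (rule exec_While_count)
    fix k s' assume k: "k < b" "G s'" "?J k s'"
    have "wp c (\<lambda>s''. Inv (Suc k) (update s'' i 0 (Suc k))) s'" using k step by blast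
    then have "wp c (wp (Assign i (Const 0) (Plus (Cell i (Const 0)) (Const 1))) (?J (Suc k))) s'"
    proof (rule wp_conseq)
      fix s'' assume s'': "G s''" "agree (writes c) s' s''" "Inv (Suc k) (update s'' i 0 (Suc k))"
      have "s'' i 0 = k" using agreeD[OF s''(2) \<open>i \<notin> writes c\<close>] k by simp
      moreover have "agree (insert i (writes c)) s (update s'' i 0 (Suc k))"
        using k(3) s''(2) by (auto simp: agree_def)
      ultimately show "wp (Assign i (Const 0) (Plus (Cell i (Const 0)) (Const 1))) (?J (Suc k)) s''"
        using s'' upd[of s'' "Suc k"] k(1) by (intro wp_Assign[OF _ refl]) auto
    qed
    then show "eval_expr ?t s' \<noteq> 0 \<and> wp ?c (?J (Suc k)) s'"
      using bound[OF k(2)] k by (auto intro: wp_Seq)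
  qed (use assms in \<open>auto simp: agree_def\<close>)
  then obtain t m s' where w: "exec (While ?t ?c) ?s t m s'"
    "t \<le> b * (1 + expr_cost ?t + time_bound Z ?c) + (1 + expr_cost ?t)" "m \<le> M" "G s'" "?J b s'"
    by auto
  \<comment> \<open>The cost 3 is one for the assignment and one for each of its two
    constants.\<close>
  have a: "exec (Assign i (Const 0) (Const 0)) s 3 (max (state_bits s) (state_bits ?s)) ?s"
    using exec.Assign[of ?s s i "Const 0" "Const 0"] by (simp add: eval_nat_numeral)
  have "t \<le> Z * (1 + expr_cost ?t + time_bound Z ?c) + (1 + expr_cost ?t)"
    using w(2) mult_le_mono1[OF \<open>b \<le> Z\<close>, of "1 + expr_cost ?t + time_bound Z ?c"] by linarith
  then have "3 + t \<le> time_bound Z (For i e c)" by (simp add: For_def)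
  moreover have "max (max (state_bits s) (state_bits ?s)) m \<le> M"
    using w(3) space[OF \<open>G s\<close>] space[of ?s] upd[OF \<open>G s\<close>] by simp
  moreover have "exec (For i e c) s (3 + t) (max (max (state_bits s) (state_bits ?s)) m) s'"
    unfolding For_def using exec.Seq[OF a w(1)] .
  ultimately show ?thesis unfolding wp_def using w post by blast
qed

end

text \<open>Truncated subtraction from 1 is the zero test; all connectives and comparisons reduce to
  it and return 0 or 1.\<close>

definition not_e :: "expr \<Rightarrow> expr" where "not_e e = Minus (Const 1) e"
definition and_e :: "expr \<Rightarrow> expr \<Rightarrow> expr" where "and_e e1 e2 = not_e (Plus (not_e e1) (not_e e2))"
definition or_e :: "expr \<Rightarrow> expr \<Rightarrow> expr" where "or_e e1 e2 = not_e (not_e (Plus e1 e2))"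
definition le_e :: "expr \<Rightarrow> expr \<Rightarrow> expr" where "le_e e1 e2 = not_e (Minus e1 e2)"
definition eq_e :: "expr \<Rightarrow> expr \<Rightarrow> expr" where "eq_e e1 e2 = and_e (le_e e1 e2) (le_e e2 e1)"

lemma eval_not_e [simp]: "eval_expr (not_e e) s = of_bool (eval_expr e s = 0)"
  by (simp add: not_e_def)
lemma eval_and_e [simp]: "eval_expr (and_e e1 e2) s = of_bool (eval_expr e1 s \<noteq> 0 \<and> eval_expr e2 s \<noteq> 0)"
  by (simp add: and_e_def)
lemma eval_or_e [simp]: "eval_expr (or_e e1 e2) s = of_bool (eval_expr e1 s \<noteq> 0 \<or> eval_expr e2 s \<noteq> 0)"
  by (simp add: or_e_def)
lemma eval_le_e [simp]: "eval_expr (le_e e1 e2) s = of_bool (eval_expr e1 s \<le> eval_expr e2 s)"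
  by (simp add: le_e_def)
lemma eval_eq_e [simp]: "eval_expr (eq_e e1 e2) s = of_bool (eval_expr e1 s = eval_expr e2 s)"
  by (auto simp: eq_e_def)


section \<open>Guesses and the greedy algorithm\<close>

text \<open>The quotient of the two sides without \<open>K\<close> tends to 0, hence is bounded. It
  is the slack left by a vertex with \<open>j\<close> intervals after paying for its
  \<open>j + 1\<close> choices.\<close>

lemma poly_le_exp: "\<exists>K. \<forall>j::nat. (j + 1) * j ^ d \<le> K * 3 ^ j"
proof -
  have "(\<lambda>j::nat. (real j + 1) * real j ^ d / 3 ^ j) \<longlonglongrightarrow> 0" by real_asymp
  then have "Bseq (\<lambda>j::nat. (real j + 1) * real j ^ d / 3 ^ j)" 
    using convergent_imp_Bseq convergentI by blast
  then obtain K where K: "\<And>j::nat. \<bar>(real j + 1) * real j ^ d / 3 ^ j\<bar> \<le> K"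
    by (auto simp: Bseq_def)
  have "(j + 1) * j ^ d \<le> nat \<lceil>K\<rceil> * 3 ^ j" for j :: nat
  proof -
    have "(real j + 1) * real j ^ d \<le> K * 3 ^ j" using K[of j] by (simp add: field_simps)
    also have "\<dots> \<le> real (nat \<lceil>K\<rceil>) * 3 ^ j" by (intro mult_right_mono) (auto simp: real_nat_ceiling_ge)
    finally have "real ((j + 1) * j ^ d) \<le> real (nat \<lceil>K\<rceil> * 3 ^ j)" by (simp add: algebra_simps)
    then show ?thesis by linarith
  qed
  then show ?thesis by blast
qed

locale interval_system =
  fixes n N :: nat and own l r :: "nat \<Rightarrow> nat"
  assumes own_less: "j < N \<Longrightarrow> own j < n"
    and l_le_r: "j < N \<Longrightarrow> l j \<le> r j"
    and owned: "v < n \<Longrightarrow> \<exists>j<N. own j = v"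
begin

definition cnt :: "nat \<Rightarrow> nat" where "cnt v = card {j. j < N \<and> own j = v}"
text \<open>Ranks start at 1, which leaves the guess value 0 free to mean membership in the
  solution.\<close>

definition rank :: "nat \<Rightarrow> nat" where "rank j = card {i. i \<le> j \<and> own i = own j}"
definition hit :: "nat \<Rightarrow> nat \<Rightarrow> bool" where "hit i j \<longleftrightarrow> l i \<le> r j \<and> l j \<le> r i"

definition dominates :: "nat set \<Rightarrow> bool" where
  "dominates D \<longleftrightarrow> D \<subseteq> {..<n} \<and>
     (\<forall>v<n. v \<notin> D \<longrightarrow> (\<exists>i j. i < N \<and> j < N \<and> own i \<in> D \<and> own j = v \<and> hit i j))"

text \<open>
  A guess \<open>g\<close> puts the vertex \<open>v\<close> into the solution if \<open>g v = 0\<close>, and otherwise demands that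
  the \<open>g v\<close>-th interval of \<open>v\<close> be hit.  The truncated difference \<open>2 - cnt v\<close> is \<open>1\<close> for
  vertices with one interval, about which nothing is guessed, and \<open>0\<close> for all others.
\<close>

definition guess :: "(nat \<Rightarrow> nat) \<Rightarrow> bool" where
  "guess g \<longleftrightarrow> (\<forall>v<n. 2 - cnt v \<le> g v \<and> g v \<le> cnt v)"

text \<open>An interval demanded by the guess drops out if a vertex guessed into the solution
  already hits it. A vertex with one interval always has guess 1, the rank of that interval, so its
  domination is demanded in the same way.\<close>

definition target :: "(nat \<Rightarrow> nat) \<Rightarrow> nat \<Rightarrow> bool" where
  "target g j \<longleftrightarrow> j < N \<and> g (own j) = rank j \<and> \<not> (\<exists>i<N. g (own i) = 0 \<and> hit i j)"

text \<open>Vertices with several intervals are decided by the guess; only those with one interval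
  are still open to choice.\<close>

definition candidates :: "nat set" where
  "candidates = {j. j < N \<and> cnt (own j) = 1}"

definition covers :: "(nat \<Rightarrow> bool) \<Rightarrow> nat set \<Rightarrow> bool" where
  "covers T S \<longleftrightarrow> S \<subseteq> candidates \<and> (\<forall>j. T j \<longrightarrow> (\<exists>c\<in>S. hit c j))"

definition feasible :: "(nat \<Rightarrow> nat) \<Rightarrow> nat \<Rightarrow> bool" where
  "feasible g p \<longleftrightarrow> (\<exists>S. covers (target g) S \<and> card {v. v < n \<and> g v = 0} + card S \<le> p)"

lemma finite_candidates [simp]: "finite candidates"
  by (simp add: candidates_def)

lemma cnt_pos: "v < n \<Longrightarrow> 1 \<le> cnt v"
  using owned[of v] card_gt_0_iff[of "{j. j < N \<and> own j = v}"] by (auto simp: cnt_def)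

lemma cnt_le: "cnt v \<le> N"
  using card_mono[of "{..<N}" "{j. j < N \<and> own j = v}"] by (auto simp: cnt_def)

lemma sum_cnt: "(\<Sum>v<n. cnt v) = N"
proof -
  have "(\<Sum>v<n. sum (\<lambda>_. 1 :: nat) {j \<in> {..<N}. own j = v}) = sum (\<lambda>_. 1) {..<N}"
    by (rule sum.group) (auto simp: own_less)
  then show ?thesis by (simp add: cnt_def)
qed

lemma n_le_N: "n \<le> N"
  using sum_mono[of "{..<n}" "\<lambda>_. 1" cnt] cnt_pos by (simp add: sum_cnt)

lemma rank_le_cnt: "j < N \<Longrightarrow> rank j \<le> cnt (own j)"
  unfolding rank_def cnt_def by (rule card_mono) auto

lemma rank_pos: "1 \<le> rank j"
  using card_gt_0_iff[of "{i. i \<le> j \<and> own i = own j}"] by (auto simp: rank_def)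

lemma rank_less:
  assumes "own i = own j" and "i < j" shows "rank i < rank j"
proof -
  let ?A = "\<lambda>j. {k. k \<le> j \<and> own k = own j}"
  have "?A i \<subseteq> ?A j" "j \<in> ?A j" "j \<notin> ?A i" using assms by auto
  then have "?A i \<subset> ?A j" by blast
  then show ?thesis unfolding rank_def by (intro psubset_card_mono) auto
qed

lemma rank_inj: "own i = own j \<Longrightarrow> rank i = rank j \<Longrightarrow> i = j"
  using rank_less[of i j] rank_less[of j i] by (cases i j rule: linorder_cases) auto

lemma ex_rank:
  assumes "1 \<le> x" and "x \<le> cnt v"
  shows "\<exists>j<N. own j = v \<and> rank j = x"
proof -
  let ?A = "{j. j < N \<and> own j = v}"
  have "rank ` ?A \<subseteq> {1..cnt v}" using rank_pos rank_le_cnt by auto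
  moreover have "card (rank ` ?A) = cnt v"
    unfolding cnt_def by (rule card_image, rule inj_onI, rule rank_inj) auto
  ultimately have "rank ` ?A = {1..cnt v}" by (intro card_subset_eq) auto
  then have "x \<in> rank ` ?A" using assms by simp
  then show ?thesis by auto
qed

section \<open>Feasible guesses and dominating sets\<close>

lemma feasible_imp_dominates:
  assumes g: "guess g" and "feasible g p"
  shows "\<exists>D. dominates D \<and> card D \<le> p"
proof -
  obtain S where S: "covers (target g) S" and le: "card {v. v < n \<and> g v = 0} + card S \<le> p"
    using assms(2) unfolding feasible_def by blast
  let ?D = "{v. v < n \<and> g v = 0} \<union> own ` S"
  have SN: "S \<subseteq> {..<N}" using S by (auto simp: covers_def candidates_def)
  have finS: "finite S" using SN finite_subset by blast
  have "\<exists>i j. i < N \<and> j < N \<and> own i \<in> ?D \<and> own j = v \<and> hit i j" if v: "v < n" "v \<notin> ?D" for v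
  proof -
    have "1 \<le> g v" "g v \<le> cnt v" using v g by (auto simp: guess_def Suc_le_eq)
    then obtain j where j: "j < N" "own j = v" "rank j = g v" using ex_rank by blast
    \<comment> \<open>If the demanded interval is no target, then by definition of
      \<open>target\<close> a vertex guessed into the solution hits it.\<close>
    show ?thesis
    proof (cases "target g j")
      case True
      then obtain c where "c \<in> S" "hit c j" using S by (auto simp: covers_def)
      then show ?thesis using SN j by blast
    next
      case False
      then show ?thesis using j own_less by (fastforce simp: target_def)
    qed
  qed
  then have "dominates ?D" using SN own_less by (auto simp: dominates_def)
  moreover have "card ?D \<le> p"
    using card_Un_le[of "{v. v < n \<and> g v = 0}" "own ` S"] card_image_le[OF finS, of own] le by linarith
  ultimately show ?thesis by blast
qed

text \<open>Each vertex outside \<open>D\<close> names an interval \<open>w v\<close> that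
  \<open>D\<close> hits. The vertices of \<open>D\<close> with several intervals are paid for by the
  guess, those with one interval form \<open>S\<close>, and the two groups are disjoint.\<close>

lemma dominates_imp_feasible:
  assumes D: "dominates D" and "card D \<le> p"
  shows "\<exists>g. guess g \<and> feasible g p"
proof -
  have sub: "D \<subseteq> {..<n}" using D by (simp add: dominates_def)
  have finD: "finite D" using sub finite_subset by blast
  have "\<exists>j. j < N \<and> own j = v \<and> (v \<notin> D \<longrightarrow> (\<exists>i<N. own i \<in> D \<and> hit i j))" if "v < n" for v
    using D owned[OF that] that unfolding dominates_def by (cases "v \<in> D") blast+
  then obtain w where w: "\<And>v. v < n \<Longrightarrow> w v < N \<and> own (w v) = v \<and>
      (v \<notin> D \<longrightarrow> (\<exists>i<N. own i \<in> D \<and> hit i (w v)))" by metis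
  \<comment> \<open>For \<open>v\<close> in \<open>D\<close> this is 0 if \<open>v\<close> has
    several intervals and 1, the only admissible value, if it has one.\<close>
  define g where "g v = (if v \<in> D then 2 - cnt v else rank (w v))" for v
  have guess: "guess g" unfolding guess_def
  proof (intro allI impI)
    fix v assume v: "v < n"
    have "2 - cnt v \<le> 1" "1 \<le> rank (w v)" "rank (w v) \<le> cnt v" "1 \<le> cnt v"
      using cnt_pos[OF v] rank_pos[of "w v"] rank_le_cnt[of "w v"] w[OF v] by auto
    then have "2 - cnt v \<le> cnt v" "2 - cnt v \<le> rank (w v)" "rank (w v) \<le> cnt v" by linarith+
    then show "2 - cnt v \<le> g v \<and> g v \<le> cnt v" by (simp add: g_def)
  qed
  define S where "S = {j \<in> candidates. own j \<in> D}"
  have single: "i = j" if "i \<in> candidates" "j < N" "own i = own j" for i j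
  proof -
    have "rank i = 1" "rank j = 1"
      using that rank_pos[of i] rank_pos[of j] rank_le_cnt[of i] rank_le_cnt[of j]
      by (auto simp: candidates_def)
    then show ?thesis using rank_inj that by simp
  qed
  have "covers (target g) S" unfolding covers_def
  proof (intro conjI allI impI)
    show "S \<subseteq> candidates" by (auto simp: S_def)
    fix j assume "target g j"
    then have j: "j < N" "g (own j) = rank j" "\<And>i. i < N \<Longrightarrow> g (own i) = 0 \<Longrightarrow> \<not> hit i j"
      by (auto simp: target_def)
    show "\<exists>c\<in>S. hit c j"
    proof (cases "own j \<in> D")
      \<comment> \<open>A target owned by a vertex of \<open>D\<close> belongs to a vertex with one
        interval; that interval lies in \<open>S\<close> and hits itself.\<close>
      case True
      then have "2 - cnt (own j) = rank j" using j by (simp add: g_def)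
      then have "cnt (own j) = 1" using rank_pos[of j] cnt_pos[OF own_less[OF j(1)]] by linarith
      then have "j \<in> S" using True j by (simp add: S_def candidates_def)
      moreover have "hit j j" using l_le_r[OF j(1)] by (simp add: hit_def)
      ultimately show ?thesis by blast
    next
      case False
      have wj: "w (own j) = j"
        using False j w[OF own_less[OF j(1)]] by - (rule rank_inj, auto simp: g_def)
      then obtain i where i: "i < N" "own i \<in> D" "hit i j"
        using False w[OF own_less[OF j(1)]] by auto
      \<comment> \<open>A vertex of \<open>D\<close> with several intervals has guess 0, and then
        \<open>j\<close> would not be a target.\<close>
      have "2 - cnt (own i) \<noteq> 0" using j(3)[OF i(1)] i by (auto simp: g_def)
      then have "cnt (own i) = 1" using cnt_pos[OF own_less[OF i(1)]] by linarith
      then show ?thesis using i by (auto simp: S_def candidates_def)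
    qed
  qed
  moreover have "card {v. v < n \<and> g v = 0} + card S \<le> p"
  proof -
    have inj: "inj_on own S"
      by (rule inj_onI, rule single) (auto simp: S_def candidates_def)
    have disj: "{v. v < n \<and> g v = 0} \<inter> own ` S = {}"
      by (auto simp: S_def candidates_def g_def)
    have "v \<in> D" if "g v = 0" for v
      using that rank_pos[of "w v"] unfolding g_def by (cases "v \<in> D") simp_all
    then have "{v. v < n \<and> g v = 0} \<union> own ` S \<subseteq> D" by (auto simp: S_def)
    then have "card ({v. v < n \<and> g v = 0} \<union> own ` S) \<le> card D" using finD by (rule card_mono[rotated])
    moreover have "card ({v. v < n \<and> g v = 0} \<union> own ` S) = card {v. v < n \<and> g v = 0} + card S"
      using disj card_image[OF inj] by (subst card_Un_disjoint) (auto simp: S_def)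
    ultimately show ?thesis using assms(2) by linarith
  qed
  ultimately show ?thesis using guess unfolding feasible_def by blast
qed

text \<open>Domination is inherited by supersets, so size at most \<open>p\<close> can be raised to
  exactly \<open>p\<close> as long as there are \<open>p\<close> vertices. This is why the program
  also tests \<open>p \<le> n\<close>.\<close>

lemma dominates_extend:
  assumes "dominates D" and "card D \<le> p" and "p \<le> n"
  shows "\<exists>D'. dominates D' \<and> card D' = p"
proof -
  have sub: "D \<subseteq> {..<n}" using assms by (simp add: dominates_def)
  obtain D' where D': "D \<subseteq> D'" "D' \<subseteq> {..<n}" "card D' = p"
    using exists_subset_between[OF assms(2) _ sub] assms(3) by auto
  then have "dominates D'" using assms(1) unfolding dominates_def by blast
  then show ?thesis using D' by blast
qed

lemma dominates_iff_feasible: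
  "(\<exists>D. dominates D \<and> card D = p) \<longleftrightarrow> p \<le> n \<and> (\<exists>g. guess g \<and> feasible g p)"
proof
  assume "\<exists>D. dominates D \<and> card D = p"
  then obtain D where D: "dominates D" "card D = p" by blast
  then have "p \<le> n" using card_mono[of "{..<n}" D] by (auto simp: dominates_def)
  then show "p \<le> n \<and> (\<exists>g. guess g \<and> feasible g p)" using D dominates_imp_feasible by auto
next
  assume "p \<le> n \<and> (\<exists>g. guess g \<and> feasible g p)"
  then show "\<exists>D. dominates D \<and> card D = p"
    using feasible_imp_dominates dominates_extend by blast
qed

text \<open>
  The state of the greedy algorithm is the number \<open>c\<close> of chosen candidates and the number
  \<open>q\<close>, one more than their largest right end (\<open>0\<close> at the start).  Because targets are
  processed by increasing right end, a target is still missed iff \<open>q\<close> is at most its left end.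
\<close>

definition greedy_inv :: "(nat \<Rightarrow> bool) \<Rightarrow> nat \<Rightarrow> nat \<Rightarrow> nat \<Rightarrow> bool" where
  "greedy_inv T k c q \<longleftrightarrow> c \<le> k \<and>
     (\<exists>S\<subseteq>candidates. card S \<le> c \<and> (\<forall>j. T j \<and> l j < q \<longrightarrow> (\<exists>i\<in>S. hit i j))) \<and>
     (\<forall>S. covers T S \<longrightarrow> c \<le> card {i \<in> S. r i < q} \<and> card {j. T j \<and> q \<le> l j} \<le> N - k)"

lemma greedy_inv_init:
  assumes "\<And>j. T j \<Longrightarrow> j < N" shows "greedy_inv T 0 0 0"
proof -
  have "card {j. T j} \<le> card {..<N}" by (rule card_mono) (use assms in auto)
  then show ?thesis by (auto simp: greedy_inv_def)
qed

lemma greedy_inv_stop: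
  assumes "greedy_inv T k c q" and "\<And>j. T j \<Longrightarrow> l j < q"
  shows "greedy_inv T (Suc k) c q"
proof -
  have none: "{j. T j \<and> q \<le> l j} = {}" using assms(2) by (fastforce simp: not_le)
  show ?thesis using assms(1) unfolding greedy_inv_def none by auto
qed

text \<open>Any cover has to hit \<open>j\<close> with some interval \<open>i\<close>. Its right end
  is at least \<open>l j \<ge> q\<close>, so \<open>i\<close> is not yet counted, and it is below
  \<open>q'\<close> by maximality; hence the lower bound on every cover grows together with
  \<open>c\<close>. Moreover \<open>j\<close> itself stops being missed, which gives
  progress.\<close>

lemma greedy_inv_step:
  assumes inv: "greedy_inv T k c q" and TN: "\<And>j. T j \<Longrightarrow> j < N"
    and j: "T j" "q \<le> l j" and min: "\<And>i. T i \<Longrightarrow> q \<le> l i \<Longrightarrow> r j \<le> r i"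
    and "q \<le> q'" and max: "\<And>i. i \<in> candidates \<Longrightarrow> l i \<le> r j \<Longrightarrow> r i < q'"
    and att: "q' = q \<or> (\<exists>i\<in>candidates. l i \<le> r j \<and> q' = Suc (r i))"
  shows "greedy_inv T (Suc k) (Suc c) q'"
  unfolding greedy_inv_def
proof (intro conjI allI impI)
  show "Suc c \<le> Suc k" using inv by (simp add: greedy_inv_def)
  obtain S where S: "S \<subseteq> candidates" "card S \<le> c" "\<And>j. T j \<Longrightarrow> l j < q \<Longrightarrow> \<exists>i\<in>S. hit i j"
    using inv unfolding greedy_inv_def by blast
  from att show "\<exists>S\<subseteq>candidates. card S \<le> Suc c \<and> (\<forall>j. T j \<and> l j < q' \<longrightarrow> (\<exists>i\<in>S. hit i j))"
  proof
    \<comment> \<open>No candidate improves \<open>q\<close>, yet \<open>c\<close> grows. Only the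
      upper bound on \<open>card S\<close> is at stake here; the lower bound below is vacuous, since
      a cover would yield \<open>q \<le> r i < q'\<close>.\<close>
    assume "q' = q"
    then show ?thesis using S by (intro exI[of _ S]) auto
  next
    assume "\<exists>i\<in>candidates. l i \<le> r j \<and> q' = Suc (r i)"
    then obtain i where i: "i \<in> candidates" "l i \<le> r j" "q' = Suc (r i)" by blast
    have "\<exists>i\<in>insert i S. hit i j'" if "T j'" "l j' < q'" for j'
    proof (cases "l j' < q")
      case True
      then show ?thesis using S(3) that by blast
    next
      case False
      \<comment> \<open>The target \<open>j'\<close> was missed, so minimality gives
        \<open>l i \<le> r j \<le> r j'\<close>; the other inequality is
        \<open>l j' < Suc (r i)\<close>.\<close>
      then have "hit i j'" using min[OF that(1)] i that by (auto simp: hit_def)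
      then show ?thesis by blast
    qed
    moreover have "card (insert i S) \<le> Suc c"
      using S(2) card_insert_le_m1[of "Suc c" S i] by simp
    ultimately show ?thesis using i S(1) by (intro exI[of _ "insert i S"]) auto
  qed
next
  fix S assume cov: "covers T S"
  then obtain i where i: "i \<in> S" "hit i j" "i \<in> candidates" using j unfolding covers_def by blast
  have "finite S" using cov finite_subset[OF _ finite_candidates] by (auto simp: covers_def)
  have ri: "q \<le> r i" "r i < q'" using i max[of i] j by (auto simp: hit_def)
  have "Suc c \<le> Suc (card {i \<in> S. r i < q})" using inv cov by (auto simp: greedy_inv_def)
  also have "\<dots> = card (insert i {i \<in> S. r i < q})" using ri \<open>finite S\<close> by simp
  also have "\<dots> \<le> card {i \<in> S. r i < q'}"
    by (rule card_mono) (use ri i \<open>q \<le> q'\<close> \<open>finite S\<close> in auto)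
  finally show "Suc c \<le> card {i \<in> S. r i < q'}" .
  have fin: "finite {j. T j \<and> q \<le> l j}" by (rule finite_subset[of _ "{..<N}"]) (use TN in auto)
  have "j \<notin> {j. T j \<and> q' \<le> l j}" using i(2) ri by (auto simp: hit_def)
  then have "{j. T j \<and> q' \<le> l j} \<subset> {j. T j \<and> q \<le> l j}" using j \<open>q \<le> q'\<close> by auto
  then have "card {j. T j \<and> q' \<le> l j} < card {j. T j \<and> q \<le> l j}" using fin by (rule psubset_card_mono[rotated])
  moreover have "card {j. T j \<and> q \<le> l j} \<le> N - k" using inv cov by (auto simp: greedy_inv_def)
  ultimately show "card {j. T j \<and> q' \<le> l j} \<le> N - Suc k" by linarith
qed

text \<open>If a cover exists, the progress clause leaves \<open>N - N = 0\<close> missed targets,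
  and \<open>c\<close> is a lower bound for the cover. Conversely, if nothing is missed, the set
  built by the algorithm is a cover of size at most \<open>c\<close>. The number \<open>b\<close>
  stands for the vertices guessed into the solution.\<close>

lemma greedy_inv_final:
  assumes inv: "greedy_inv T N c q" and TN: "\<And>j. T j \<Longrightarrow> j < N"
  shows "(\<forall>j. T j \<longrightarrow> l j < q) \<and> b + c \<le> p \<longleftrightarrow> (\<exists>S. covers T S \<and> b + card S \<le> p)"
proof
  assume L: "(\<forall>j. T j \<longrightarrow> l j < q) \<and> b + c \<le> p"
  obtain S where "S \<subseteq> candidates" "card S \<le> c" "\<And>j. T j \<Longrightarrow> l j < q \<Longrightarrow> \<exists>i\<in>S. hit i j"
    using inv unfolding greedy_inv_def by blast
  then show "\<exists>S. covers T S \<and> b + card S \<le> p" using L by (intro exI[of _ S]) (auto simp: covers_def)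
next
  assume "\<exists>S. covers T S \<and> b + card S \<le> p"
  then obtain S where S: "covers T S" "b + card S \<le> p" by blast
  have "finite S" using S finite_subset[OF _ finite_candidates] by (auto simp: covers_def)
  then have "card {i \<in> S. r i < q} \<le> card S" by (intro card_mono) auto
  moreover have c: "c \<le> card {i \<in> S. r i < q}" "card {j. T j \<and> q \<le> l j} \<le> 0"
    using inv S by (auto simp: greedy_inv_def)
  moreover have "finite {j. T j \<and> q \<le> l j}" by (rule finite_subset[of _ "{..<N}"]) (use TN in auto)
  ultimately have "{j. T j \<and> q \<le> l j} = {}" by simp
  then show "(\<forall>j. T j \<longrightarrow> l j < q) \<and> b + c \<le> p"
    using c S(2) \<open>card {i \<in> S. r i < q} \<le> card S\<close> by (auto simp: not_le)
qed

section \<open>Numbering and counting the guesses\<close>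

definition base :: "nat \<Rightarrow> nat" where "base v = cnt v + 1 - (2 - cnt v)"
text \<open>The place value of digit \<open>m\<close>, where digit \<open>v\<close> has
  \<open>base v\<close> values: \<open>cnt v + 1\<close> for several intervals and 1 for a single
  one. In particular \<open>weight n\<close> is the number of guesses, up to values outside the
  vertex set.\<close>

definition weight :: "nat \<Rightarrow> nat" where "weight m = (\<Prod>v<m. base v)"
definition guess_value :: "(nat \<Rightarrow> nat) \<Rightarrow> nat \<Rightarrow> nat" where
  "guess_value g m = (\<Sum>v<m. (g v - (2 - cnt v)) * weight v)"

lemma weight_Suc [simp]: "weight (Suc m) = weight m * base m"
  by (simp add: weight_def)

lemma weight_0 [simp]: "weight 0 = 1"
  by (simp add: weight_def)

lemma guess_value_Suc: "guess_value g (Suc m) = guess_value g m + (g m - (2 - cnt m)) * weight m"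
  by (simp add: guess_value_def)

lemma guess_value_0 [simp]: "guess_value g 0 = 0"
  by (simp add: guess_value_def)

lemma guess_digit_less: "guess g \<Longrightarrow> v < n \<Longrightarrow> g v - (2 - cnt v) < base v"
  using cnt_pos[of v] by (auto simp: guess_def base_def)

lemma guess_value_less:
  assumes "guess g" and "m \<le> n" shows "guess_value g m < weight m"
  using assms(2)
proof (induction m)
  case (Suc m)
  have "(g m - (2 - cnt m)) + 1 \<le> base m" using guess_digit_less[OF assms(1), of m] Suc by simp
  then have "((g m - (2 - cnt m)) + 1) * weight m \<le> base m * weight m" by (rule mult_le_mono1)
  then show ?case using Suc by (simp add: guess_value_Suc algebra_simps)
qed simp

text \<open>Division by \<open>weight m\<close> recovers the leading digit, because the lower digits
  add up to less than \<open>weight m\<close>.\<close>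

lemma guess_value_inj:
  assumes "guess g" and "guess h" and "m \<le> n" and "guess_value g m = guess_value h m" and "v < m"
  shows "g v = h v"
  using assms(3-5)
proof (induction m)
  case (Suc m)
  let ?d = "\<lambda>g. g m - (2 - cnt m)"
  have less: "guess_value g m < weight m" "guess_value h m < weight m"
    using guess_value_less assms(1,2) Suc.prems(1) by auto
  have eq: "guess_value g m + ?d g * weight m = guess_value h m + ?d h * weight m"
    using Suc.prems(2) by (simp add: guess_value_Suc)
  have "(guess_value g m + ?d g * weight m) div weight m = ?d g"
    "(guess_value h m + ?d h * weight m) div weight m = ?d h" using less by auto
  then have d: "?d g = ?d h" using eq by simp
  then have "guess_value g m = guess_value h m" using eq by simp
  then have "g v = h v" if "v < m" using Suc that by simp
  moreover have "g m = h m"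
    using d assms(1,2) Suc.prems(1) unfolding guess_def by (metis Suc_le_eq eq_diff_iff)
  ultimately show ?case using Suc.prems(3) less_Suc_eq by auto
qed simp

lemma guess_least: "guess (\<lambda>v. 2 - cnt v)"
  unfolding guess_def
proof (intro allI impI conjI le_refl)
  fix v assume "v < n"
  then show "2 - cnt v \<le> cnt v" using cnt_pos[of v] by linarith
qed

lemma weight_pos: "0 < weight n"
  using guess_value_less[OF guess_least, of n] by simp

text \<open>Guesses are total functions, but a number in mixed radix determines them only on the
  vertices; feasibility does not see the difference.\<close>

lemma feasible_cong:
  assumes "\<And>v. v < n \<Longrightarrow> g v = h v" shows "feasible g p \<longleftrightarrow> feasible h p"
proof -
  have "target g = target h"
    using assms own_less by (intro ext) (auto simp: target_def)
  moreover have "{v. v < n \<and> g v = 0} = {v. v < n \<and> h v = 0}" using assms by auto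
  ultimately show ?thesis by (simp add: feasible_def)
qed

text \<open>Equality holds for two intervals, with three choices against \<open>3 ^ 1\<close>; this
  case is the origin of the base 3.\<close>

lemma base_le: "v < n \<Longrightarrow> base v \<le> 3 ^ (cnt v - 1)"
proof -
  have "j + 2 \<le> 3 ^ j" if "1 \<le> j" for j :: nat using that by (induction j rule: dec_induct) auto
  from this[of "cnt v - 1"] show "v < n \<Longrightarrow> base v \<le> 3 ^ (cnt v - 1)"
    using cnt_pos[of v] by (cases "cnt v = 1") (auto simp: base_def)
qed

text \<open>
  A vertex with \<open>j\<close> intervals contributes at most \<open>j + 1\<close> to the number of guesses, but
  \<open>3 ^ (j - 1)\<close> to \<open>3 ^ (N - n)\<close>.  The gap for the vertex with the most intervals pays for
  \<open>N\<close> being possibly superpolynomial in \<open>n\<close>.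
\<close>

lemma weight_mult_poly_le:
  assumes K: "\<And>j. (j + 1) * j ^ d \<le> K * 3 ^ j" and "0 < n"
  shows "weight n * (N + 1) ^ d \<le> 3 * K * 2 ^ d * 3 ^ (N - n) * n ^ d"
proof -
  define J where "J = Max (cnt ` {..<n})"
  have fin: "finite (cnt ` {..<n})" "cnt ` {..<n} \<noteq> {}" using assms(2) by auto
  obtain v0 where v0: "v0 < n" "cnt v0 = J" using Max_in[OF fin] unfolding J_def by auto
  have le: "cnt v \<le> J" if "v < n" for v using that by (auto simp: J_def)
  have "1 \<le> J" using cnt_pos v0 by auto
  have "N \<le> n * J" using sum_bounded_above[of "{..<n}" cnt J] le sum_cnt by simp
  moreover have "1 \<le> n * J" using \<open>1 \<le> J\<close> assms(2) by simp
  \<comment> \<open>This separates the power of \<open>N\<close> into a power of \<open>n\<close>,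
    which is allowed in the result, and a power of \<open>J\<close>, to be charged to
    \<open>v0\<close>.\<close>
  ultimately have "N + 1 \<le> 2 * n * J" unfolding mult.assoc by linarith
  then have N: "(N + 1) ^ d \<le> 2 ^ d * n ^ d * J ^ d"
    using power_mono[of "N + 1" "2 * n * J" d] by (simp add: power_mult_distrib)
  have split: "weight n = base v0 * (\<Prod>v\<in>{..<n} - {v0}. base v)"
    unfolding weight_def using v0 by (intro prod.remove) auto
  \<comment> \<open>The slack of \<open>v0\<close> is spent here; the factor 3 makes up for the
    exponent \<open>J - 1\<close> in place of \<open>J\<close>.\<close>
  have b: "base v0 * J ^ d \<le> 3 * K * 3 ^ (cnt v0 - 1)"
  proof -
    have "base v0 \<le> J + 1" using v0 by (simp add: base_def)
    then have "base v0 * J ^ d \<le> (J + 1) * J ^ d" by (rule mult_le_mono1)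
    also have "\<dots> \<le> K * 3 ^ J" by (rule K)
    also have "\<dots> = 3 * K * 3 ^ (cnt v0 - 1)" using \<open>1 \<le> J\<close> v0 by (cases J) auto
    finally show ?thesis .
  qed
  have p: "(\<Prod>v\<in>{..<n} - {v0}. base v) \<le> (\<Prod>v\<in>{..<n} - {v0}. 3 ^ (cnt v - 1))"
    by (rule prod_mono) (use base_le in auto)
  have "(\<Sum>v<n. cnt v - 1) = N - n"
    using sum_subtractf_nat[of "{..<n}" "\<lambda>_. 1" cnt] cnt_pos by (simp add: sum_cnt)
  then have "(3::nat) ^ (N - n) = (\<Prod>v<n. 3 ^ (cnt v - 1))" by (simp flip: power_sum)
  also have "\<dots> = 3 ^ (cnt v0 - 1) * (\<Prod>v\<in>{..<n} - {v0}. 3 ^ (cnt v - 1))"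
    using v0 by (intro prod.remove) auto
  finally have e: "(3::nat) ^ (N - n) = 3 ^ (cnt v0 - 1) * (\<Prod>v\<in>{..<n} - {v0}. 3 ^ (cnt v - 1))" .
  have "weight n * (N + 1) ^ d \<le> weight n * (2 ^ d * n ^ d * J ^ d)" using N by simp
  also have "\<dots> = (base v0 * J ^ d) * (\<Prod>v\<in>{..<n} - {v0}. base v) * (2 ^ d * n ^ d)"
    by (simp add: split)
  also have "\<dots> \<le> (3 * K * 3 ^ (cnt v0 - 1)) * (\<Prod>v\<in>{..<n} - {v0}. 3 ^ (cnt v - 1)) * (2 ^ d * n ^ d)"
    by (intro mult_le_mono b p le_refl)
  also have "\<dots> = 3 * K * 2 ^ d * 3 ^ (N - n) * n ^ d" by (simp add: e)
  finally show ?thesis .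
qed

end


section \<open>The program\<close>

lemma bit_length_mono: "x \<le> y \<Longrightarrow> bit_length x \<le> bit_length y"
  using floor_log_mono by (auto simp: bit_length_def mono_def)

lemma bit_length_le_Suc: "bit_length x \<le> Suc x"
proof (cases "x = 0")
  case False
  then have "2 ^ floor_log x \<le> x" by (simp add: floor_log_exp2_le)
  moreover have "floor_log x < 2 ^ floor_log x" by simp
  ultimately show ?thesis unfolding bit_length_def by linarith
qed (simp add: bit_length_def)

text \<open>At most \<open>A * I\<close> cells are nonzero. Addresses are charged crudely with
  \<open>A\<close> and \<open>I\<close> bits instead of logarithms, which still gives polynomial
  space.\<close>

lemma state_bits_le:
  assumes "\<And>a i. s a i \<noteq> 0 \<Longrightarrow> a < A \<and> i < I \<and> s a i \<le> V"
  shows "state_bits s \<le> A * I * (A + I + bit_length V)"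
proof -
  have sub: "support s \<subseteq> {..<A} \<times> {..<I}" using assms by (auto simp: support_def)
  have "(case x of (a, i) \<Rightarrow> bit_length a + bit_length i + bit_length (s a i)) \<le> A + I + bit_length V"
    if "x \<in> support s" for x
  proof -
    obtain a i where x: "x = (a, i)" by fastforce
    then have "a < A" "i < I" "s a i \<le> V" using that assms by (auto simp: support_def)
    then show ?thesis
      using bit_length_le_Suc[of a] bit_length_le_Suc[of i] bit_length_mono[of "s a i" V] x by auto
  qed
  then have "state_bits s \<le> of_nat (card (support s)) * (A + I + bit_length V)"
    unfolding state_bits_def by (rule sum_bounded_above)
  then have "state_bits s \<le> card (support s) * (A + I + bit_length V)" by simp
  also have "card (support s) \<le> A * I" using card_mono[OF _ sub] by simp
  finally show ?thesis by simp
qed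

lemma card_less_Suc: "card {j. j < Suc k \<and> P j} = card {j. j < k \<and> P j} + of_bool (P k)"
proof -
  have "{j. j < Suc k \<and> P j} = (if P k then insert k {j. j < k \<and> P j} else {j. j < k \<and> P j})"
    by (auto simp: less_Suc_eq)
  then show ?thesis by simp
qed

abbreviation var :: "nat \<Rightarrow> expr" where "var a \<equiv> Cell a (Const 0)"

definition n_e :: expr where "n_e = Cell 0 (Const 0)"
definition p_e :: expr where "p_e = Cell 0 (Const 1)"
definition N_e :: expr where "N_e = Cell 0 (Const 2)"
text \<open>The header fills cells 0 to 2, so triple \<open>j\<close> starts at cell
  \<open>3 + 3 * j\<close>; without multiplication, three times \<open>e\<close> is a sum.\<close>

definition own_e :: "expr \<Rightarrow> expr" where "own_e e = Cell 0 (Plus (Const 3) (Plus e (Plus e e)))"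
definition l_e :: "expr \<Rightarrow> expr" where "l_e e = Cell 0 (Plus (Const 4) (Plus e (Plus e e)))"
definition r_e :: "expr \<Rightarrow> expr" where "r_e e = Cell 0 (Plus (Const 5) (Plus e (Plus e e)))"

text \<open>
  Memory layout: 0 input, 1 answer, 2 number of intervals of each vertex, 3 rank of each interval,
  4 current guess, 5 flags of the targets, 6 carry of the odometer, 7 size of the solution,
  8 the number \<open>q\<close> of the greedy algorithm, 9 one more than the smallest right end of a missed
  target (0 if there is none), 10 success of the greedy algorithm, 11 and 12 loop counters.
\<close>

definition prep_prog :: prog where
  "prep_prog = For 11 N_e
     (Seq (Assign 2 (own_e (var 11)) (Plus (Cell 2 (own_e (var 11))) (Const 1)))
          (Assign 3 (var 11) (Cell 2 (own_e (var 11)))))"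

definition init_prog :: prog where
  "init_prog = For 11 n_e (Assign 4 (var 11) (Minus (Const 2) (Cell 2 (var 11))))"

definition count_prog :: prog where
  "count_prog = Seq (Assign 7 (Const 0) (Const 0))
     (For 11 n_e
        (If (not_e (Cell 4 (var 11))) (Assign 7 (Const 0) (Plus (var 7) (Const 1))) Skip))"

definition unflag_prog :: prog where
  "unflag_prog = For 12 N_e
     (If (and_e (not_e (Cell 4 (own_e (var 12))))
            (and_e (le_e (l_e (var 12)) (r_e (var 11))) (le_e (l_e (var 11)) (r_e (var 12)))))
        (Assign 5 (var 11) (Const 0)) Skip)"

definition target_prog :: prog where
  "target_prog = For 11 N_e
     (Seq (Assign 5 (var 11) (eq_e (Cell 3 (var 11)) (Cell 4 (own_e (var 11))))) unflag_prog)"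

definition missed_prog :: prog where
  "missed_prog = Seq (Assign 9 (Const 0) (Const 0)) (For 12 N_e
     (If (and_e (and_e (Cell 5 (var 12)) (le_e (var 8) (l_e (var 12))))
            (or_e (not_e (var 9)) (le_e (Plus (r_e (var 12)) (Const 1)) (var 9))))
        (Assign 9 (Const 0) (Plus (r_e (var 12)) (Const 1))) Skip))"

text \<open>As array 9 holds a right end plus one, the second test says that the candidate starts no
  later than that right end. Starting from the current \<open>q\<close> keeps \<open>q\<close> from
  decreasing.\<close>

definition choose_prog :: prog where
  "choose_prog = For 12 N_e
     (If (and_e (eq_e (Cell 2 (own_e (var 12))) (Const 1))
            (and_e (not_e (le_e (var 9) (l_e (var 12)))) (le_e (var 8) (r_e (var 12)))))
        (Assign 8 (Const 0) (Plus (r_e (var 12)) (Const 1))) Skip)"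

definition greedy_prog :: prog where
  "greedy_prog = Seq (Assign 8 (Const 0) (Const 0)) (For 11 N_e
     (Seq missed_prog
        (If (var 9) (Seq (Assign 7 (Const 0) (Plus (var 7) (Const 1))) choose_prog) Skip)))"

text \<open>The answer cell is set but never cleared, so it accumulates the disjunction over all
  guesses checked so far.\<close>

definition verdict_prog :: prog where
  "verdict_prog = Seq (Assign 10 (Const 0) (Const 1)) (Seq
     (For 11 N_e
        (If (and_e (Cell 5 (var 11)) (le_e (var 8) (l_e (var 11))))
           (Assign 10 (Const 0) (Const 0)) Skip))
     (If (and_e (var 10) (and_e (le_e (var 7) p_e) (le_e p_e n_e)))
        (Assign 1 (Const 0) (Const 1)) Skip))"

definition check_prog :: prog where
  "check_prog = Seq count_prog (Seq target_prog (Seq greedy_prog verdict_prog))"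

text \<open>A digit at its maximum returns to its minimum and passes the carry on; any other digit
  grows by one and absorbs it. Vertices with one interval have minimum and maximum 1 and just pass
  the carry.\<close>

definition next_prog :: prog where
  "next_prog = Seq (Assign 6 (Const 0) (Const 1)) (For 11 n_e
     (If (var 6)
        (If (eq_e (Cell 4 (var 11)) (Cell 2 (var 11)))
           (Assign 4 (var 11) (Minus (Const 2) (Cell 2 (var 11))))
           (Seq (Assign 4 (var 11) (Plus (Cell 4 (var 11)) (Const 1)))
                (Assign 6 (Const 0) (Const 0))))
        Skip))"

text \<open>The carry is 0 in the initial memory, so the least guess is checked as well; the loop
  stops once a carry leaves the last digit.\<close>

definition domset_prog :: prog where
  "domset_prog = Seq prep_prog (Seq init_prog (While (not_e (var 6)) (Seq check_prog next_prog)))"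

section \<open>Correctness and resources of the subroutines\<close>

locale domset_run = interval_system +
  fixes p I V :: nat
  assumes N_le_I: "N \<le> I" and I_pos: "0 < I"
    and V_pos: "1 \<le> V" and nN_le_V: "n + N \<le> V" and r_less_V: "j < N \<Longrightarrow> r j < V"
begin

text \<open>The first line is the box that bounds space: arrays 0 to 12, addresses below
  \<open>I\<close>, values up to \<open>V\<close>. The rest records that the input stays
  intact.\<close>

definition good :: "state \<Rightarrow> bool" where
  "good s \<longleftrightarrow> (\<forall>a i. s a i \<noteq> 0 \<longrightarrow> a < 13 \<and> i < I \<and> s a i \<le> V) \<and>
     s 0 0 = n \<and> s 0 1 = p \<and> s 0 2 = N \<and>
     (\<forall>j<N. s 0 (3 + (j + (j + j))) = own j \<and> s 0 (4 + (j + (j + j))) = l j \<and>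
        s 0 (5 + (j + (j + j))) = r j)"

sublocale bounded_run good "13 * I * (13 + I + bit_length V)" N
proof
  fix s assume "good s"
  then have "\<forall>a i. s a i \<noteq> 0 \<longrightarrow> a < 13 \<and> i < I \<and> s a i \<le> V" unfolding good_def by (rule conjunct1)
  then show "state_bits s \<le> 13 * I * (13 + I + bit_length V)" by (intro state_bits_le) blast
qed

lemma good_update:
  assumes "good s" and "0 < a" "a < 13" "i < I" "x \<le> V"
  shows "good (update s a i x)"
proof -
  have "b < 13 \<and> j < I \<and> update s a i x b j \<le> V" if "update s a i x b j \<noteq> 0" for b j
  proof (cases "b = a \<and> j = i")
    case True
    then show ?thesis using assms by simp
  next
    case False
    then have "update s a i x b j = s b j" by (auto simp: update_def)
    moreover have "\<forall>a i. s a i \<noteq> 0 \<longrightarrow> a < 13 \<and> i < I \<and> s a i \<le> V"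
      using assms(1) unfolding good_def by (rule conjunct1)
    ultimately show ?thesis using that by metis
  qed
  moreover have "update s a i x 0 = s 0" using assms(2) by simp
  ultimately show ?thesis using assms(1) unfolding good_def by presburger
qed

lemma eval_input [simp]:
  assumes "good s"
  shows "eval_expr n_e s = n" "eval_expr p_e s = p" "eval_expr N_e s = N"
    "eval_expr e s < N \<Longrightarrow> eval_expr (own_e e) s = own (eval_expr e s)"
    "eval_expr e s < N \<Longrightarrow> eval_expr (l_e e) s = l (eval_expr e s)"
    "eval_expr e s < N \<Longrightarrow> eval_expr (r_e e) s = r (eval_expr e s)"
  using assms by (auto simp: good_def n_e_def p_e_def N_e_def own_e_def l_e_def r_e_def)

lemma wp_assign:
  assumes "good s" and "eval_expr e1 s = i" and "eval_expr e2 s = x"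
    and "0 < a" "a < 13" "i < I" "x \<le> V" and "Q (update s a i x)"
  shows "wp (Assign a e1 e2) Q s"
  using assms by (intro wp_Assign[OF _ refl]) (auto intro: good_update)

lemma wp_for_N:
  assumes "good s" and "0 < i" "i < 13" "i \<notin> writes c"
    and "Inv 0 (update s i 0 0)"
    and "\<And>k s'. k < N \<Longrightarrow> good s' \<Longrightarrow> s' i 0 = k \<Longrightarrow> agree (insert i (writes c)) s s' \<Longrightarrow>
      Inv k s' \<Longrightarrow> wp c (\<lambda>s''. Inv (Suc k) (update s'' i 0 (Suc k))) s'"
    and "\<And>s'. good s' \<Longrightarrow> agree (insert i (writes c)) s s' \<Longrightarrow> Inv N s' \<Longrightarrow> Q s'"
  shows "wp (For i N_e c) Q s"
proof (rule wp_For[where Inv = Inv and b = N])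
  fix s x assume "good s" "x \<le> N"
  then show "good (update s i 0 x)" using assms(2,3) I_pos nN_le_V by (intro good_update) auto
qed (fact assms n_le_N le_refl | simp)+

lemma wp_for_n:
  assumes "good s" and "0 < i" "i < 13" "i \<notin> writes c"
    and "Inv 0 (update s i 0 0)"
    and "\<And>k s'. k < n \<Longrightarrow> good s' \<Longrightarrow> s' i 0 = k \<Longrightarrow> agree (insert i (writes c)) s s' \<Longrightarrow>
      Inv k s' \<Longrightarrow> wp c (\<lambda>s''. Inv (Suc k) (update s'' i 0 (Suc k))) s'"
    and "\<And>s'. good s' \<Longrightarrow> agree (insert i (writes c)) s s' \<Longrightarrow> Inv n s' \<Longrightarrow> Q s'"
  shows "wp (For i n_e c) Q s"
proof (rule wp_For[where Inv = Inv and b = n])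
  fix s x assume "good s" "x \<le> n"
  then show "good (update s i 0 x)" using assms(2,3) I_pos nN_le_V by (intro good_update) auto
qed (fact assms n_le_N le_refl | simp)+

lemma cnt_upto_le: "k \<le> N \<Longrightarrow> card {j. j < k \<and> P j} \<le> N"
  using card_mono[of "{..<k}" "{j. j < k \<and> P j}"] by fastforce

lemma wp_prep:
  assumes "good s" and "\<And>v. s 2 v = 0"
  shows "wp prep_prog (\<lambda>s'. (\<forall>v. s' 2 v = cnt v) \<and> (\<forall>j<N. s' 3 j = rank j)) s"
  unfolding prep_prog_def
proof (rule wp_for_N[where Inv = "\<lambda>k s. (\<forall>v. s 2 v = card {j. j < k \<and> own j = v}) \<and> (\<forall>j<k. s 3 j = rank j)"])
  fix k s'
  assume k: "k < N" "good s'" "s' 11 0 = k"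
    and inv: "(\<forall>v. s' 2 v = card {j. j < k \<and> own j = v}) \<and> (\<forall>j<k. s' 3 j = rank j)"
  let ?x = "Suc (s' 2 (own k))"
  have rank: "?x = rank k" 
    using inv card_less_Suc[of k "\<lambda>j. own j = own k"] by (simp add: rank_def less_Suc_eq_le)
  have x: "?x \<le> V" using rank rank_le_cnt[of k] cnt_le[of "own k"] k nN_le_V by linarith
  have i: "own k < I" "k < I" using own_less[OF k(1)] n_le_N N_le_I k by auto
  show "wp (Seq (Assign 2 (own_e (var 11)) (Plus (Cell 2 (own_e (var 11))) (Const 1)))
          (Assign 3 (var 11) (Cell 2 (own_e (var 11)))))
     (\<lambda>s''. (\<forall>v. update s'' 11 0 (Suc k) 2 v = card {j. j < Suc k \<and> own j = v}) \<and>
       (\<forall>j<Suc k. update s'' 11 0 (Suc k) 3 j = rank j)) s'"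
  proof (rule wp_Seq, rule wp_assign[where i = "own k" and x = ?x])
    let ?s = "update s' 2 (own k) ?x"
    have g: "good ?s" using k x i by (intro good_update) auto
    show "wp (Assign 3 (var 11) (Cell 2 (own_e (var 11)))) (\<lambda>s''. (\<forall>v. update s'' 11 0 (Suc k) 2 v = card {j. j < Suc k \<and> own j = v}) \<and>
       (\<forall>j<Suc k. update s'' 11 0 (Suc k) 3 j = rank j)) ?s"
      using g k x i inv rank by (intro wp_assign[where i = k and x = ?x]) (auto simp: card_less_Suc All_less_Suc)
  qed (use k x i in auto)
qed (use assms in \<open>auto simp: cnt_def\<close>)

lemma wp_init:
  assumes "good s" and "\<And>v. s 2 v = cnt v"
  shows "wp init_prog (\<lambda>s'. \<forall>v<n. s' 4 v = 2 - cnt v) s"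
  unfolding init_prog_def
proof (rule wp_for_n[where Inv = "\<lambda>k s. \<forall>v<k. s 4 v = 2 - cnt v"])
  fix k s'
  assume k: "k < n" "good s'" "s' 11 0 = k" and inv: "\<forall>v<k. s' 4 v = 2 - cnt v"
    and a: "agree (insert 11 (writes (Assign 4 (var 11) (Minus (Const 2) (Cell 2 (var 11)))))) s s'"
  have "s' 2 k = cnt k" using agreeD[OF a, of 2] assms by simp
  moreover have "2 - cnt k \<le> V" "k < I" using cnt_pos[OF k(1)] V_pos n_le_N N_le_I k by auto
  ultimately show "wp (Assign 4 (var 11) (Minus (Const 2) (Cell 2 (var 11))))
     (\<lambda>s''. \<forall>v<Suc k. update s'' 11 0 (Suc k) 4 v = 2 - cnt v) s'"
    using k inv by (intro wp_assign[where i = k and x = "2 - cnt k"]) (auto simp: less_Suc_eq)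
qed (use assms in auto)

lemma wp_count:
  assumes "good s"
  shows "wp count_prog (\<lambda>s'. s' 7 0 = card {v. v < n \<and> s 4 v = 0}) s"
  unfolding count_prog_def
proof (rule wp_Seq, rule wp_assign[where i = 0 and x = 0])
  let ?s = "update s 7 0 0" and ?c = "If (not_e (Cell 4 (var 11))) (Assign 7 (Const 0) (Plus (var 7) (Const 1))) Skip"
  have g: "good ?s" using assms I_pos by (intro good_update) auto
  show "wp (For 11 n_e ?c) (\<lambda>s'. s' 7 0 = card {v. v < n \<and> s 4 v = 0}) ?s"
  proof (rule wp_for_n[where Inv = "\<lambda>k s'. s' 7 0 = card {v. v < k \<and> s 4 v = 0}"])
    fix k s'
    assume k: "k < n" "good s'" "s' 11 0 = k" and a: "agree (insert 11 (writes ?c)) ?s s'"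
      and inv: "s' 7 0 = card {v. v < k \<and> s 4 v = 0}"
    have 4: "s' 4 = s 4" using agreeD[OF a, of 4] by simp
    have "s' 7 0 < V" using inv cnt_upto_le[of k "\<lambda>v. s 4 v = 0"] k n_le_N nN_le_V by simp
    then show "wp ?c (\<lambda>s''. update s'' 11 0 (Suc k) 7 0 = card {v. v < Suc k \<and> s 4 v = 0}) s'"
      using k inv I_pos
      by (intro wp_If wp_Skip wp_assign[where i = 0 and x = "Suc (s' 7 0)"]) (auto simp: card_less_Suc 4)
  qed (use g in auto)
qed (use assms I_pos in auto)

lemma wp_unflag:
  assumes "good s" and "s 11 0 = j" and "j < N"
  shows "wp unflag_prog (\<lambda>s'. (\<forall>i. i \<noteq> j \<longrightarrow> s' 5 i = s 5 i) \<and>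
    (s' 5 j \<noteq> 0 \<longleftrightarrow> s 5 j \<noteq> 0 \<and> \<not> (\<exists>i<N. s 4 (own i) = 0 \<and> hit i j))) s"
  unfolding unflag_prog_def
proof (rule wp_for_N[where Inv = "\<lambda>k s'. (\<forall>i. i \<noteq> j \<longrightarrow> s' 5 i = s 5 i) \<and>
    (s' 5 j \<noteq> 0 \<longleftrightarrow> s 5 j \<noteq> 0 \<and> \<not> (\<exists>i<k. s 4 (own i) = 0 \<and> hit i j))"])
  fix k s'
  let ?e = "and_e (not_e (Cell 4 (own_e (var 12))))
            (and_e (le_e (l_e (var 12)) (r_e (var 11))) (le_e (l_e (var 11)) (r_e (var 12))))"
  let ?c = "If ?e (Assign 5 (var 11) (Const 0)) Skip"
  assume k: "k < N" "good s'" "s' 12 0 = k" and a: "agree (insert 12 (writes ?c)) s s'"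
    and inv: "(\<forall>i. i \<noteq> j \<longrightarrow> s' 5 i = s 5 i) \<and>
      (s' 5 j \<noteq> 0 \<longleftrightarrow> s 5 j \<noteq> 0 \<and> \<not> (\<exists>i<k. s 4 (own i) = 0 \<and> hit i j))"
  have fr: "s' 4 = s 4" "s' 11 0 = j" using agreeD[OF a, of 4] agreeD[OF a, of 11] assms by simp_all
  have e: "eval_expr ?e s' \<noteq> 0 \<longleftrightarrow> s 4 (own k) = 0 \<and> hit k j"
    using k fr assms by (auto simp: hit_def)
  have "j < I" using assms N_le_I by simp
  show "wp ?c (\<lambda>s''. (\<forall>i. i \<noteq> j \<longrightarrow> update s'' 12 0 (Suc k) 5 i = s 5 i) \<and>
      (update s'' 12 0 (Suc k) 5 j \<noteq> 0 \<longleftrightarrow> s 5 j \<noteq> 0 \<and> \<not> (\<exists>i<Suc k. s 4 (own i) = 0 \<and> hit i j))) s'"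
  proof (rule wp_If)
    assume "eval_expr ?e s' \<noteq> 0"
    then have "s 4 (own k) = 0 \<and> hit k j" using e by simp
    then show "wp (Assign 5 (var 11) (Const 0)) (\<lambda>s''. (\<forall>i. i \<noteq> j \<longrightarrow> update s'' 12 0 (Suc k) 5 i = s 5 i) \<and>
      (update s'' 12 0 (Suc k) 5 j \<noteq> 0 \<longleftrightarrow> s 5 j \<noteq> 0 \<and> \<not> (\<exists>i<Suc k. s 4 (own i) = 0 \<and> hit i j))) s'"
      using k fr inv \<open>j < I\<close> by (intro wp_assign[where i = j and x = 0]) auto
  next
    assume "eval_expr ?e s' = 0"
    then have "\<not> (s 4 (own k) = 0 \<and> hit k j)" using e by simp
    then show "wp Skip (\<lambda>s''. (\<forall>i. i \<noteq> j \<longrightarrow> update s'' 12 0 (Suc k) 5 i = s 5 i) \<and>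
      (update s'' 12 0 (Suc k) 5 j \<noteq> 0 \<longleftrightarrow> s 5 j \<noteq> 0 \<and> \<not> (\<exists>i<Suc k. s 4 (own i) = 0 \<and> hit i j))) s'"
      using k(2) inv by (intro wp_Skip) (auto simp: less_Suc_eq)
  qed
qed (use assms in auto)

lemma wp_target:
  assumes "good s" and rank: "\<And>j. j < N \<Longrightarrow> s 3 j = rank j"
  shows "wp target_prog (\<lambda>s'. \<forall>j<N. s' 5 j \<noteq> 0 \<longleftrightarrow> target (s 4) j) s"
  unfolding target_prog_def
proof (rule wp_for_N[where Inv = "\<lambda>k s'. \<forall>j<k. s' 5 j \<noteq> 0 \<longleftrightarrow> target (s 4) j"])
  fix k s'
  let ?a = "Assign 5 (var 11) (eq_e (Cell 3 (var 11)) (Cell 4 (own_e (var 11))))"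
  assume k: "k < N" "good s'" "s' 11 0 = k" and a: "agree (insert 11 (writes (Seq ?a unflag_prog))) s s'"
    and inv: "\<forall>j<k. s' 5 j \<noteq> 0 \<longleftrightarrow> target (s 4) j"
  have fr: "s' 4 = s 4" "s' 3 = s 3"
    using agreeD[OF a, of 4] agreeD[OF a, of 3] by (simp_all add: unflag_prog_def)
  let ?x = "of_bool (s 3 k = s 4 (own k))" and ?P = "\<lambda>s''. \<forall>j<Suc k. update s'' 11 0 (Suc k) 5 j \<noteq> 0 \<longleftrightarrow> target (s 4) j"
  let ?s = "update s' 5 k ?x"
  have i: "k < I" "?x \<le> V" using k N_le_I V_pos by auto
  have g: "good ?s" using k i by (intro good_update) auto
  have "wp unflag_prog ?P ?s"
  proof (rule wp_conseq[OF wp_unflag[of ?s k]])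
    fix s'' :: state assume *: "(\<forall>i. i \<noteq> k \<longrightarrow> s'' 5 i = ?s 5 i) \<and>
      (s'' 5 k \<noteq> 0 \<longleftrightarrow> ?s 5 k \<noteq> 0 \<and> \<not> (\<exists>i<N. ?s 4 (own i) = 0 \<and> hit i k))"
    show "?P s''"
    proof (intro allI impI)
      fix j assume "j < Suc k"
      then consider "j < k" | "j = k" by linarith
      then show "update s'' 11 0 (Suc k) 5 j \<noteq> 0 \<longleftrightarrow> target (s 4) j"
      proof cases
        case 1
        then show ?thesis using * inv by simp
      next
        case 2
        then show ?thesis using * k rank[OF k(1)] by (auto simp: target_def fr)
      qed
    qed
  qed (use g k in auto)
  then show "wp (Seq ?a unflag_prog) ?P s'"
    using k fr i by (intro wp_Seq wp_assign[where i = k and x = ?x]) auto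
qed (use assms in \<open>auto simp: unflag_prog_def\<close>)

lemma wp_missed:
  assumes "good s" and T: "\<And>j. j < N \<Longrightarrow> s 5 j \<noteq> 0 \<longleftrightarrow> T j"
  shows "wp missed_prog (\<lambda>s'. if s' 9 0 = 0 then \<forall>j<N. T j \<longrightarrow> l j < s 8 0
     else \<exists>j<N. T j \<and> s 8 0 \<le> l j \<and> s' 9 0 = Suc (r j) \<and> (\<forall>i<N. T i \<longrightarrow> s 8 0 \<le> l i \<longrightarrow> r j \<le> r i)) s"
  unfolding missed_prog_def
proof (rule wp_Seq, rule wp_assign[where i = 0 and x = 0])
  let ?s = "update s 9 0 0"
  let ?e = "and_e (and_e (Cell 5 (var 12)) (le_e (var 8) (l_e (var 12))))
            (or_e (not_e (var 9)) (le_e (Plus (r_e (var 12)) (Const 1)) (var 9)))"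
  let ?c = "If ?e (Assign 9 (Const 0) (Plus (r_e (var 12)) (Const 1))) Skip"
  let ?J = "\<lambda>k s'. if s' 9 0 = 0 then \<forall>j<k. T j \<longrightarrow> l j < s 8 0
     else \<exists>j<N. T j \<and> s 8 0 \<le> l j \<and> s' 9 0 = Suc (r j) \<and> (\<forall>i<k. T i \<longrightarrow> s 8 0 \<le> l i \<longrightarrow> r j \<le> r i)"
  have g: "good ?s" using assms I_pos by (intro good_update) auto
  show "wp (For 12 N_e ?c) (?J N) ?s"
  proof (rule wp_for_N[where Inv = ?J])
    fix k s'
    assume k: "k < N" "good s'" "s' 12 0 = k" and a: "agree (insert 12 (writes ?c)) ?s s'"
      and inv: "?J k s'"
    have fr: "s' 5 = s 5" "s' 8 = s 8" using agreeD[OF a, of 5] agreeD[OF a, of 8] by simp_all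
    have e: "eval_expr ?e s' \<noteq> 0 \<longleftrightarrow> T k \<and> s 8 0 \<le> l k \<and> (s' 9 0 = 0 \<or> r k < s' 9 0)"
      using k T[OF k(1)] by (auto simp: fr)
    show "wp ?c (\<lambda>s''. ?J (Suc k) (update s'' 12 0 (Suc k))) s'"
    proof (rule wp_If)
      assume "eval_expr ?e s' \<noteq> 0"
      with e have T: "T k" "s 8 0 \<le> l k" "s' 9 0 = 0 \<or> r k < s' 9 0" by auto
      have "Suc (r k) \<le> V" using r_less_V[OF k(1)] by simp
      moreover have "?J (Suc k) (update (update s' 9 0 (Suc (r k))) 12 0 (Suc k))"
        using T inv k(1) by (cases "s' 9 0 = 0") (fastforce simp: less_Suc_eq)+
      ultimately show "wp (Assign 9 (Const 0) (Plus (r_e (var 12)) (Const 1))) (\<lambda>s''. ?J (Suc k) (update s'' 12 0 (Suc k))) s'"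
        using k I_pos by (intro wp_assign[where i = 0 and x = "Suc (r k)"]) auto
    next
      assume "eval_expr ?e s' = 0"
      with e have "\<not> (T k \<and> s 8 0 \<le> l k \<and> (s' 9 0 = 0 \<or> r k < s' 9 0))" by blast
      then have "?J (Suc k) (update s' 12 0 (Suc k))" using inv by (auto simp: less_Suc_eq split: if_splits)
      then show "wp Skip (\<lambda>s''. ?J (Suc k) (update s'' 12 0 (Suc k))) s'" using k by (intro wp_Skip)
    qed
  qed (use g in auto)
qed (use assms I_pos in auto)


lemma wp_choose:
  assumes "good s" and cnt: "\<And>v. v < n \<Longrightarrow> s 2 v = cnt v" and x: "s 9 0 = Suc x"
  shows "wp choose_prog (\<lambda>s'. s 8 0 \<le> s' 8 0 \<and> (\<forall>i\<in>candidates. l i \<le> x \<longrightarrow> r i < s' 8 0) \<and>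
    (s' 8 0 = s 8 0 \<or> (\<exists>i\<in>candidates. l i \<le> x \<and> s' 8 0 = Suc (r i)))) s"
  unfolding choose_prog_def
proof (rule wp_for_N[where Inv = "\<lambda>k s'. s 8 0 \<le> s' 8 0 \<and>
    (\<forall>i\<in>candidates. i < k \<longrightarrow> l i \<le> x \<longrightarrow> r i < s' 8 0) \<and>
    (s' 8 0 = s 8 0 \<or> (\<exists>i\<in>candidates. l i \<le> x \<and> s' 8 0 = Suc (r i)))"])
  fix k s'
  let ?e = "and_e (eq_e (Cell 2 (own_e (var 12))) (Const 1))
            (and_e (not_e (le_e (var 9) (l_e (var 12)))) (le_e (var 8) (r_e (var 12))))"
  let ?c = "If ?e (Assign 8 (Const 0) (Plus (r_e (var 12)) (Const 1))) Skip"
  let ?J = "\<lambda>k s'. s 8 0 \<le> s' 8 0 \<and>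
    (\<forall>i\<in>candidates. i < k \<longrightarrow> l i \<le> x \<longrightarrow> r i < s' 8 0) \<and>
    (s' 8 0 = s 8 0 \<or> (\<exists>i\<in>candidates. l i \<le> x \<and> s' 8 0 = Suc (r i)))"
  assume k: "k < N" "good s'" "s' 12 0 = k" and a: "agree (insert 12 (writes ?c)) s s'"
    and inv: "?J k s'"
  have fr: "s' 2 = s 2" "s' 9 0 = Suc x"
    using agreeD[OF a, of 2] agreeD[OF a, of 9] x by simp_all
  have e: "eval_expr ?e s' \<noteq> 0 \<longleftrightarrow> k \<in> candidates \<and> l k \<le> x \<and> s' 8 0 \<le> r k"
    using k fr cnt[OF own_less[OF k(1)]] by (auto simp: candidates_def)
  show "wp ?c (\<lambda>s''. ?J (Suc k) (update s'' 12 0 (Suc k))) s'"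
  proof (rule wp_If)
    assume "eval_expr ?e s' \<noteq> 0"
    with e have e': "k \<in> candidates" "l k \<le> x" "s' 8 0 \<le> r k" by auto
    have "Suc (r k) \<le> V" using r_less_V[OF k(1)] by simp
    moreover have "?J (Suc k) (update (update s' 8 0 (Suc (r k))) 12 0 (Suc k))"
      using e' inv by (fastforce simp: less_Suc_eq)
    ultimately show "wp (Assign 8 (Const 0) (Plus (r_e (var 12)) (Const 1)))
        (\<lambda>s''. ?J (Suc k) (update s'' 12 0 (Suc k))) s'"
      using k I_pos by (intro wp_assign[where i = 0 and x = "Suc (r k)"]) auto
  next
    assume "eval_expr ?e s' = 0"
    with e have "\<not> (k \<in> candidates \<and> l k \<le> x \<and> s' 8 0 \<le> r k)" by simp
    then have "?J (Suc k) (update s' 12 0 (Suc k))" using inv by (auto simp: less_Suc_eq)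
    then show "wp Skip (\<lambda>s''. ?J (Suc k) (update s'' 12 0 (Suc k))) s'" using k by (intro wp_Skip)
  qed
qed (use assms in \<open>auto simp: candidates_def\<close>)

lemma wp_greedy:
  assumes "good s" and cnt: "\<And>v. v < n \<Longrightarrow> s 2 v = cnt v"
    and T: "\<And>j. j < N \<Longrightarrow> s 5 j \<noteq> 0 \<longleftrightarrow> T j" and TN: "\<And>j. T j \<Longrightarrow> j < N" and "s 7 0 \<le> n"
  shows "wp greedy_prog (\<lambda>s'. \<exists>c. s' 7 0 = s 7 0 + c \<and> greedy_inv T N c (s' 8 0)) s"
  unfolding greedy_prog_def
proof (rule wp_Seq, rule wp_assign[where i = 0 and x = 0])
  let ?s = "update s 8 0 0"
  let ?i = "If (var 9) (Seq (Assign 7 (Const 0) (Plus (var 7) (Const 1))) choose_prog) Skip"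
  let ?c = "Seq missed_prog ?i"
  let ?J = "\<lambda>k s'. \<exists>c. s' 7 0 = s 7 0 + c \<and> greedy_inv T k c (s' 8 0)"
  have g: "good ?s" using assms I_pos by (intro good_update) auto
  show "wp (For 11 N_e ?c) (?J N) ?s"
  proof (rule wp_for_N[where Inv = ?J])
    fix k s'
    assume k: "k < N" "good s'" "s' 11 0 = k" and a: "agree (insert 11 (writes ?c)) ?s s'"
      and inv: "?J k s'"
    have fr: "s' 5 = s 5" "s' 2 = s 2"
      using agreeD[OF a, of 5] agreeD[OF a, of 2] by (simp_all add: missed_prog_def choose_prog_def)
    obtain c where c: "s' 7 0 = s 7 0 + c" "greedy_inv T k c (s' 8 0)" using inv by blast
    have "c \<le> k" using c(2) by (simp add: greedy_inv_def)
    \<comment> \<open>The clause \<open>c \<le> k\<close> of \<open>greedy_inv\<close> serves this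
      bound: the solution size stays within \<open>n + N\<close>.\<close>
    then have x: "Suc (s' 7 0) \<le> V" using c(1) k(1) assms(5) nN_le_V by linarith
    have "wp missed_prog (wp ?i (\<lambda>s''. ?J (Suc k) (update s'' 11 0 (Suc k)))) s'"
    proof (rule wp_conseq[OF wp_missed[OF k(2), of T]])
      fix s1
      assume g1: "good s1" and a1: "agree (writes missed_prog) s' s1"
        and m: "if s1 9 0 = 0 then \<forall>j<N. T j \<longrightarrow> l j < s' 8 0
          else \<exists>j<N. T j \<and> s' 8 0 \<le> l j \<and> s1 9 0 = Suc (r j) \<and>
            (\<forall>i<N. T i \<longrightarrow> s' 8 0 \<le> l i \<longrightarrow> r j \<le> r i)"
      have fr1: "s1 2 = s 2" "s1 7 = s' 7" "s1 8 = s' 8"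
        using agreeD[OF a1, of 2] agreeD[OF a1, of 7] agreeD[OF a1, of 8] fr
        by (simp_all add: missed_prog_def)
      show "wp ?i (\<lambda>s''. ?J (Suc k) (update s'' 11 0 (Suc k))) s1"
      proof (rule wp_If)
        assume "eval_expr (var 9) s1 = 0"
        then have "\<And>j. T j \<Longrightarrow> l j < s' 8 0" using m TN by simp
        then have "greedy_inv T (Suc k) c (s' 8 0)" using greedy_inv_stop c(2) by blast
        then show "wp Skip (\<lambda>s''. ?J (Suc k) (update s'' 11 0 (Suc k))) s1"
          using g1 c(1) by (intro wp_Skip) (auto simp: fr1)
      next
        assume "eval_expr (var 9) s1 \<noteq> 0"
        then obtain j where j: "T j" "s' 8 0 \<le> l j" "s1 9 0 = Suc (r j)"
          "\<And>i. T i \<Longrightarrow> s' 8 0 \<le> l i \<Longrightarrow> r j \<le> r i" using m TN by auto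
        let ?s1 = "update s1 7 0 (Suc (s' 7 0))"
        have g2: "good ?s1" using g1 x I_pos by (intro good_update) auto
        have "wp choose_prog (\<lambda>s''. ?J (Suc k) (update s'' 11 0 (Suc k))) ?s1"
        proof (rule wp_conseq[OF wp_choose[OF g2, of "r j"]])
          fix s2
          assume a2: "agree (writes choose_prog) ?s1 s2"
            and q: "?s1 8 0 \<le> s2 8 0 \<and> (\<forall>i\<in>candidates. l i \<le> r j \<longrightarrow> r i < s2 8 0) \<and>
              (s2 8 0 = ?s1 8 0 \<or> (\<exists>i\<in>candidates. l i \<le> r j \<and> s2 8 0 = Suc (r i)))"
          have "s2 7 0 = s 7 0 + Suc c" using agreeD[OF a2, of 7] c(1) by (simp add: choose_prog_def)
          moreover have "greedy_inv T (Suc k) (Suc c) (s2 8 0)"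
            by (rule greedy_inv_step[OF c(2) TN j(1,2,4)]) (use q in \<open>auto simp: fr1\<close>)
          ultimately show "?J (Suc k) (update s2 11 0 (Suc k))" by auto
        qed (use cnt j fr1 in auto)
        then show "wp (Seq (Assign 7 (Const 0) (Plus (var 7) (Const 1))) choose_prog)
            (\<lambda>s''. ?J (Suc k) (update s'' 11 0 (Suc k))) s1"
          using g1 x I_pos fr1 by (intro wp_Seq wp_assign[where i = 0 and x = "Suc (s' 7 0)"]) auto
      qed
    qed (use T fr in auto)
    then show "wp ?c (\<lambda>s''. ?J (Suc k) (update s'' 11 0 (Suc k))) s'" by (rule wp_Seq)
  qed (use g greedy_inv_init[of T] TN in \<open>auto simp: missed_prog_def choose_prog_def\<close>)
qed (use assms I_pos in auto)

lemma wp_verdict: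
  assumes "good s" and T: "\<And>j. j < N \<Longrightarrow> s 5 j \<noteq> 0 \<longleftrightarrow> T j"
  shows "wp verdict_prog (\<lambda>s'. s' 1 0 \<noteq> 0 \<longleftrightarrow>
    s 1 0 \<noteq> 0 \<or> (\<forall>j<N. T j \<longrightarrow> l j < s 8 0) \<and> s 7 0 \<le> p \<and> p \<le> n) s"
  unfolding verdict_prog_def
proof (rule wp_Seq, rule wp_assign[where i = 0 and x = 1], goal_cases)
  case 8
  let ?s = "update s 10 0 1"
  let ?c = "If (and_e (Cell 5 (var 11)) (le_e (var 8) (l_e (var 11)))) (Assign 10 (Const 0) (Const 0)) Skip"
  have g: "good ?s" using assms I_pos V_pos by (intro good_update) auto
  show ?case
  proof (rule wp_Seq, rule wp_for_N[where Inv = "\<lambda>k s'. s' 10 0 \<noteq> 0 \<longleftrightarrow> (\<forall>j<k. T j \<longrightarrow> l j < s 8 0)"])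
    fix k s'
    assume k: "k < N" "good s'" "s' 11 0 = k" and a: "agree (insert 11 (writes ?c)) ?s s'"
      and inv: "s' 10 0 \<noteq> 0 \<longleftrightarrow> (\<forall>j<k. T j \<longrightarrow> l j < s 8 0)"
    have fr: "s' 5 = s 5" "s' 8 = s 8" using agreeD[OF a, of 5] agreeD[OF a, of 8] by simp_all
    show "wp ?c (\<lambda>s''. update s'' 11 0 (Suc k) 10 0 \<noteq> 0 \<longleftrightarrow> (\<forall>j<Suc k. T j \<longrightarrow> l j < s 8 0)) s'"
      using k inv I_pos T[OF k(1)] fr
      by (intro wp_If wp_Skip wp_assign[where i = 0 and x = 0]) (auto simp: All_less_Suc)
  next
    fix s'
    assume g': "good s'" and a: "agree (insert 11 (writes ?c)) ?s s'"
      and inv: "s' 10 0 \<noteq> 0 \<longleftrightarrow> (\<forall>j<N. T j \<longrightarrow> l j < s 8 0)"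
    have fr: "s' 1 = s 1" "s' 7 = s 7" using agreeD[OF a, of 1] agreeD[OF a, of 7] by simp_all
    show "wp (If (and_e (var 10) (and_e (le_e (var 7) p_e) (le_e p_e n_e))) (Assign 1 (Const 0) (Const 1)) Skip)
      (\<lambda>s'. s' 1 0 \<noteq> 0 \<longleftrightarrow>
        s 1 0 \<noteq> 0 \<or> (\<forall>j<N. T j \<longrightarrow> l j < s 8 0) \<and> s 7 0 \<le> p \<and> p \<le> n) s'"
      using g' inv fr I_pos V_pos
      by (intro wp_If wp_Skip wp_assign[where i = 0 and x = 1]) auto
  qed (use g in auto)
qed (use assms I_pos V_pos in auto)

lemma wp_check:
  assumes "good s" and cnt: "\<And>v. v < n \<Longrightarrow> s 2 v = cnt v" and rank: "\<And>j. j < N \<Longrightarrow> s 3 j = rank j"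
  shows "wp check_prog (\<lambda>s'. s' 1 0 \<noteq> 0 \<longleftrightarrow> s 1 0 \<noteq> 0 \<or> p \<le> n \<and> feasible (s 4) p) s"
  unfolding check_prog_def
proof (rule wp_Seq, rule wp_conseq[OF wp_count[OF assms(1)]])
  fix s1 assume s1: "good s1" "agree (writes count_prog) s s1" "s1 7 0 = card {v. v < n \<and> s 4 v = 0}"
  have fr1: "s1 1 = s 1" "s1 2 = s 2" "s1 3 = s 3" "s1 4 = s 4"
    using agreeD[OF s1(2)] by (simp_all add: count_prog_def)
  let ?Q = "\<lambda>s'. s' 1 0 \<noteq> 0 \<longleftrightarrow> s 1 0 \<noteq> 0 \<or> p \<le> n \<and> feasible (s 4) p"
  show "wp (Seq target_prog (Seq greedy_prog verdict_prog)) ?Q s1"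
  proof (rule wp_Seq, rule wp_conseq[OF wp_target[OF s1(1)]])
    fix s2
    assume s2: "good s2" "agree (writes target_prog) s1 s2" "\<forall>j<N. s2 5 j \<noteq> 0 \<longleftrightarrow> target (s1 4) j"
    have fr2: "s2 1 = s 1" "s2 2 = s 2" "s2 7 = s1 7"
      using agreeD[OF s2(2)] fr1 by (simp_all add: target_prog_def unflag_prog_def)
    have TN: "\<And>j. target (s 4) j \<Longrightarrow> j < N" by (simp add: target_def)
    have le: "s2 7 0 \<le> n" 
      using s1(3) card_mono[of "{..<n}" "{v. v < n \<and> s 4 v = 0}"] by (auto simp: fr2)
    show "wp (Seq greedy_prog verdict_prog) ?Q s2"
    proof (rule wp_Seq, rule wp_conseq[OF wp_greedy[OF s2(1) _ _ TN le]])
      fix s3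
      assume s3: "good s3" "agree (writes greedy_prog) s2 s3"
        "\<exists>c. s3 7 0 = s2 7 0 + c \<and> greedy_inv (target (s 4)) N c (s3 8 0)"
      then obtain c where c: "s3 7 0 = s2 7 0 + c" "greedy_inv (target (s 4)) N c (s3 8 0)" by blast
      have fr3: "s3 1 = s 1" "s3 5 = s2 5"
        using agreeD[OF s3(2)] fr2 by (simp_all add: greedy_prog_def missed_prog_def choose_prog_def)
      have "feasible (s 4) p \<longleftrightarrow> (\<forall>j. target (s 4) j \<longrightarrow> l j < s3 8 0) \<and> s3 7 0 \<le> p"
        unfolding feasible_def using greedy_inv_final[OF c(2) TN] s1(3) c(1) by (simp add: fr2)
      then have "feasible (s 4) p \<longleftrightarrow> (\<forall>j<N. target (s 4) j \<longrightarrow> l j < s3 8 0) \<and> s3 7 0 \<le> p"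
        using TN by blast
      then show "wp verdict_prog ?Q s3"
        by (intro wp_conseq[OF wp_verdict[OF s3(1), of "target (s 4)"]]) (use s2(3) fr1 fr3 in auto)
    qed (use cnt s2(3) fr1 fr2 in auto)
  qed (use rank fr1 in auto)
qed

lemma wp_next:
  assumes "good s" and cnt: "\<And>v. v < n \<Longrightarrow> s 2 v = cnt v" and "guess (s 4)"
  shows "wp next_prog (\<lambda>s'. guess (s' 4) \<and> s' 6 0 \<le> 1 \<and>
    guess_value (s' 4) n + s' 6 0 * weight n = Suc (guess_value (s 4) n)) s"
  unfolding next_prog_def
proof (rule wp_Seq, rule wp_assign[where i = 0 and x = 1], goal_cases)
  case 8
  let ?s = "update s 6 0 1"
  let ?r = "Assign 4 (var 11) (Minus (Const 2) (Cell 2 (var 11)))"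
  let ?i = "Assign 4 (var 11) (Plus (Cell 4 (var 11)) (Const 1))" and ?z = "Assign 6 (Const 0) (Const 0)"
  let ?c = "If (var 6) (If (eq_e (Cell 4 (var 11)) (Cell 2 (var 11))) ?r (Seq ?i ?z)) Skip"
  \<comment> \<open>The digits below \<open>k\<close>, together with a carry worth
    \<open>weight k\<close>, represent the old value of these digits plus one; the digits from
    \<open>k\<close> on are untouched.\<close>
  let ?J = "\<lambda>k s'. guess (s' 4) \<and> s' 6 0 \<le> 1 \<and> (\<forall>v\<ge>k. s' 4 v = s 4 v) \<and>
    guess_value (s' 4) k + s' 6 0 * weight k = Suc (guess_value (s 4) k)"
  have g: "good ?s" using assms I_pos V_pos by (intro good_update) auto
  show ?case
  proof (rule wp_for_n[where Inv = ?J])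
    fix k s'
    assume k: "k < n" "good s'" "s' 11 0 = k" and a: "agree (insert 11 (writes ?c)) ?s s'"
      and inv: "?J k s'"
    have fr: "s' 2 k = cnt k" using agreeD[OF a, of 2] cnt[OF k(1)] by simp
    have "k < I" using k(1) n_le_N N_le_I by simp
    have low: "2 - cnt k \<le> V" "2 - cnt k \<le> cnt k" using cnt_pos[OF k(1)] V_pos by linarith+
    have gk: "s' 4 k = s 4 k" "2 - cnt k \<le> s 4 k" "s 4 k \<le> cnt k"
      using inv assms(3) k(1) by (auto simp: guess_def)
    have upd: "guess ((s' 4)(k := x))" if "2 - cnt k \<le> x" "x \<le> cnt k" for x
      using inv that by (auto simp: guess_def)
    have gv: "guess_value ((s' 4)(k := x)) (Suc k) = guess_value (s' 4) k + (x - (2 - cnt k)) * weight k" for x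
      by (simp add: guess_value_def)
    have tail: "((s' 4)(k := x)) v = s 4 v" if "Suc k \<le> v" for x v
      using inv that by simp
    show "wp ?c (\<lambda>s''. ?J (Suc k) (update s'' 11 0 (Suc k))) s'"
    proof (intro wp_If)
      assume "eval_expr (var 6) s' \<noteq> 0" and "eval_expr (eq_e (Cell 4 (var 11)) (Cell 2 (var 11))) s' \<noteq> 0"
      then have c: "s' 6 0 = 1" "s 4 k = cnt k" using inv k fr gk by auto
      let ?s' = "update s' 4 k (2 - cnt k)"
      \<comment> \<open>A full digit is worth \<open>base k - 1\<close> units of
        \<open>weight k\<close>; with the incoming carry this is one unit of
        \<open>weight (Suc k)\<close>.\<close>
      have "base k = Suc (cnt k - (2 - cnt k))" using low by (simp add: base_def)
      then have "guess_value ((s' 4)(k := 2 - cnt k)) (Suc k) + weight (Suc k) = Suc (guess_value (s 4) (Suc k))"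
        using inv c by (simp add: guess_value_Suc[of "s 4"] gv del: fun_upd_apply)
      then have "?J (Suc k) (update ?s' 11 0 (Suc k))"
        using c low upd[of "2 - cnt k"] tail by (simp del: fun_upd_apply weight_Suc)
      then show "wp ?r (\<lambda>s''. ?J (Suc k) (update s'' 11 0 (Suc k))) s'"
        using k fr low \<open>k < I\<close> by (intro wp_assign[where i = k and x = "2 - cnt k"]) auto
    next
      assume "eval_expr (var 6) s' \<noteq> 0" and "eval_expr (eq_e (Cell 4 (var 11)) (Cell 2 (var 11))) s' = 0"
      then have c: "s' 6 0 = 1" "s 4 k < cnt k" using inv k fr gk by auto
      let ?s' = "update s' 4 k (Suc (s 4 k))"
      have V: "Suc (s 4 k) \<le> V" using c(2) cnt_le[of k] nN_le_V by linarith
      have g': "good ?s'" using k V \<open>k < I\<close> by (intro good_update) auto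
      have "Suc (s 4 k) - (2 - cnt k) = Suc (s 4 k - (2 - cnt k))" using gk by simp
      then have "guess_value ((s' 4)(k := Suc (s 4 k))) (Suc k) = Suc (guess_value (s 4) (Suc k))"
        using inv c by (simp add: guess_value_Suc[of "s 4"] gv del: fun_upd_apply)
      then have "?J (Suc k) (update (update ?s' 6 0 0) 11 0 (Suc k))"
        using c gk upd[of "Suc (s 4 k)"] tail by (simp add: fun_upd_same del: fun_upd_apply)
      then have "wp ?z (\<lambda>s''. ?J (Suc k) (update s'' 11 0 (Suc k))) ?s'"
        using g' I_pos by (intro wp_assign[where i = 0 and x = 0]) auto
      then show "wp (Seq ?i ?z) (\<lambda>s''. ?J (Suc k) (update s'' 11 0 (Suc k))) s'"
        using k V \<open>k < I\<close> gk by - (rule wp_Seq, rule wp_assign[where i = k and x = "Suc (s 4 k)"], auto)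
    next
      assume "eval_expr (var 6) s' = 0"
      then show "wp Skip (\<lambda>s''. ?J (Suc k) (update s'' 11 0 (Suc k))) s'"
        using k inv gk by (intro wp_Skip) (auto simp: guess_value_Suc)
    qed
  qed (use g assms in auto)
qed (use assms I_pos V_pos in auto)

lemma wp_prep_init:
  assumes "good s" and "\<And>v. s 2 v = 0"
  shows "wp (Seq prep_prog init_prog) (\<lambda>s'. (\<forall>v. s' 2 v = cnt v) \<and> (\<forall>j<N. s' 3 j = rank j) \<and>
    (\<forall>v<n. s' 4 v = 2 - cnt v) \<and> s' 1 = s 1 \<and> s' 6 = s 6) s"
proof (rule wp_Seq, rule wp_conseq[OF wp_prep[OF assms]])
  fix s1
  assume s1: "good s1" "agree (writes prep_prog) s s1"
    "(\<forall>v. s1 2 v = cnt v) \<and> (\<forall>j<N. s1 3 j = rank j)"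
  show "wp init_prog (\<lambda>s'. (\<forall>v. s' 2 v = cnt v) \<and> (\<forall>j<N. s' 3 j = rank j) \<and>
    (\<forall>v<n. s' 4 v = 2 - cnt v) \<and> s' 1 = s 1 \<and> s' 6 = s 6) s1"
  proof (rule wp_conseq[OF wp_init[OF s1(1)]])
    fix s2 assume s2: "agree (writes init_prog) s1 s2" "\<forall>v<n. s2 4 v = 2 - cnt v"
    show "(\<forall>v. s2 2 v = cnt v) \<and> (\<forall>j<N. s2 3 j = rank j) \<and>
      (\<forall>v<n. s2 4 v = 2 - cnt v) \<and> s2 1 = s 1 \<and> s2 6 = s 6"
      using s2(2) s1(3) agreeD[OF s2(1)] agreeD[OF s1(2)] by (simp add: init_prog_def prep_prog_def)
  qed (use s1 in simp)
qed

section \<open>The enumeration of all guesses\<close>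

lemma exec_search:
  assumes "good s" and "\<And>v. s 2 v = cnt v" and "\<And>j. j < N \<Longrightarrow> s 3 j = rank j"
    and "\<And>v. v < n \<Longrightarrow> s 4 v = 2 - cnt v" and "s 1 0 = 0" and "s 6 0 = 0"
  shows "\<exists>t m s'. exec (While (not_e (var 6)) (Seq check_prog next_prog)) s t m s' \<and>
    t \<le> weight n * (1 + expr_cost (not_e (var 6)) + time_bound N (Seq check_prog next_prog)) +
      (1 + expr_cost (not_e (var 6))) \<and>
    m \<le> 13 * I * (13 + I + bit_length V) \<and>
    (s' 1 0 \<noteq> 0 \<longleftrightarrow> (\<exists>D. dominates D \<and> card D = p))"
proof -
  \<comment> \<open>The index \<open>i\<close> is the number of guesses already checked and also the
    value of the current one. After the last round the counter has overflowed, so nothing is claimed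
    about the guess.\<close>
  let ?J = "\<lambda>i s. (\<forall>v. s 2 v = cnt v) \<and> (\<forall>j<N. s 3 j = rank j) \<and> (s 6 0 = 0 \<longleftrightarrow> i < weight n) \<and>
    (i < weight n \<longrightarrow> guess (s 4) \<and> guess_value (s 4) n = i) \<and>
    (s 1 0 \<noteq> 0 \<longleftrightarrow> p \<le> n \<and> (\<exists>g. guess g \<and> guess_value g n < i \<and> feasible g p))"
  have "\<exists>t m s'. exec (While (not_e (var 6)) (Seq check_prog next_prog)) s t m s' \<and>
    t \<le> (weight n - 0) * (1 + expr_cost (not_e (var 6)) + time_bound N (Seq check_prog next_prog)) +
      (1 + expr_cost (not_e (var 6))) \<and>
    m \<le> 13 * I * (13 + I + bit_length V) \<and> good s' \<and> ?J (weight n) s'"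
  proof (rule exec_While_count[where Inv = ?J])
    fix i s assume i: "i < weight n" "good s" "?J i s"
    then have J: "\<And>v. s 2 v = cnt v" "\<And>j. j < N \<Longrightarrow> s 3 j = rank j" "s 6 0 = 0"
      "guess (s 4)" "guess_value (s 4) n = i" by auto
    have eq: "(\<exists>g. guess g \<and> guess_value g n < Suc i \<and> feasible g p) \<longleftrightarrow>
      (\<exists>g. guess g \<and> guess_value g n < i \<and> feasible g p) \<or> feasible (s 4) p"
    proof -
      have "feasible g p \<longleftrightarrow> feasible (s 4) p" if "guess g" "guess_value g n = i" for g
        by (rule feasible_cong, rule guess_value_inj[of _ _ n]) (use that J in auto)
      then show ?thesis using J(4,5) less_Suc_eq by metis
    qed
    have "wp (Seq check_prog next_prog) (?J (Suc i)) s"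
    proof (rule wp_Seq, rule wp_conseq[OF wp_check[OF i(2)]])
      fix s1
      assume s1: "good s1" "agree (writes check_prog) s s1"
        "s1 1 0 \<noteq> 0 \<longleftrightarrow> s 1 0 \<noteq> 0 \<or> p \<le> n \<and> feasible (s 4) p"
      have fr1: "s1 2 = s 2" "s1 3 = s 3" "s1 4 = s 4"
        using agreeD[OF s1(2)] by (simp_all add: check_prog_def count_prog_def target_prog_def
          unflag_prog_def greedy_prog_def missed_prog_def choose_prog_def verdict_prog_def)
      show "wp next_prog (?J (Suc i)) s1"
      proof (rule wp_conseq[OF wp_next[OF s1(1)]])
        fix s2
        assume s2: "agree (writes next_prog) s1 s2"
          "guess (s2 4) \<and> s2 6 0 \<le> 1 \<and>
            guess_value (s2 4) n + s2 6 0 * weight n = Suc (guess_value (s1 4) n)"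
        have fr2: "s2 1 = s1 1" "s2 2 = s 2" "s2 3 = s 3"
          using agreeD[OF s2(1)] fr1 by (simp_all add: next_prog_def)
        have val: "guess_value (s2 4) n + s2 6 0 * weight n = Suc i" using s2(2) J(5) fr1 by simp
        have less: "guess_value (s2 4) n < weight n" using s2(2) guess_value_less by simp
        have carry: "s2 6 0 = 0 \<or> s2 6 0 = 1" using s2(2) by linarith
        \<comment> \<open>With a carry, \<open>val\<close> forces
          \<open>weight n \<le> Suc i\<close>; without one, \<open>Suc i\<close> is itself the value
          of a guess, hence below \<open>weight n\<close>.\<close>
        have c1: "s2 6 0 = 0 \<longleftrightarrow> Suc i < weight n" 
          using carry val less i(1) by auto
        have c2: "Suc i < weight n \<longrightarrow> guess (s2 4) \<and> guess_value (s2 4) n = Suc i"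
          using c1 val s2(2) by (metis add.right_neutral mult_zero_left)
        have "s2 1 0 \<noteq> 0 \<longleftrightarrow> p \<le> n \<and> (\<exists>g. guess g \<and> guess_value g n < Suc i \<and> feasible g p)"
          unfolding eq using s1(3) fr2(1) i(3) by metis
        then show "?J (Suc i) s2" using c1 c2 J(1,2) fr2 by simp
      qed (use J fr1 in auto)
    qed (use J in auto)
    then show "eval_expr (not_e (var 6)) s \<noteq> 0 \<and> wp (Seq check_prog next_prog) (?J (Suc i)) s"
      using J(3) by simp
  next
    fix s :: state assume "?J (weight n) s"
    then show "eval_expr (not_e (var 6)) s = 0" by simp
  next
    have "guess (s 4)" using guess_least assms(4) by (simp add: guess_def)
    moreover have "guess_value (s 4) n = 0" using assms(4) by (simp add: guess_value_def)
    ultimately show "?J 0 s" using assms weight_pos by simp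
  qed (use assms in simp_all)
  moreover have "(\<exists>g. guess g \<and> guess_value g n < weight n \<and> feasible g p) \<longleftrightarrow> (\<exists>g. guess g \<and> feasible g p)"
    using guess_value_less by blast
  ultimately show ?thesis unfolding dominates_iff_feasible by (metis diff_zero)
qed

lemma exec_domset:
  assumes "good s" and "\<And>v. s 2 v = 0" and "s 1 0 = 0" and "s 6 0 = 0"
  shows "\<exists>t m s'. exec domset_prog s t m s' \<and> t \<le> 2 * weight n * time_bound N domset_prog \<and>
    m \<le> 13 * I * (13 + I + bit_length V) \<and> (accepting s' \<longleftrightarrow> (\<exists>D. dominates D \<and> card D = p))"
proof -
  let ?e = "not_e (var 6)" and ?c = "Seq check_prog next_prog"
  let ?w = "While ?e ?c"
  obtain t1 m1 s1 where e1: "exec (Seq prep_prog init_prog) s t1 m1 s1"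
    "t1 \<le> time_bound N (Seq prep_prog init_prog)" "m1 \<le> 13 * I * (13 + I + bit_length V)" "good s1"
    and s1: "(\<forall>v. s1 2 v = cnt v) \<and> (\<forall>j<N. s1 3 j = rank j) \<and>
    (\<forall>v<n. s1 4 v = 2 - cnt v) \<and> s1 1 = s 1 \<and> s1 6 = s 6"
    using wp_prep_init[OF assms(1,2)] unfolding wp_def by blast
  obtain t2 m2 s2 where e2: "exec ?w s1 t2 m2 s2"
    "t2 \<le> weight n * (1 + expr_cost ?e + time_bound N ?c) + (1 + expr_cost ?e)"
    "m2 \<le> 13 * I * (13 + I + bit_length V)" "s2 1 0 \<noteq> 0 \<longleftrightarrow> (\<exists>D. dominates D \<and> card D = p)"
    using exec_search[OF e1(4)] s1 assms(3,4) by auto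
  \<comment> \<open>The sequence is nested to the right in \<open>domset_prog\<close>, so the run of
    the first two parts is split and reassembled.\<close>
  from e1(1) obtain ta tb ma mb sa where sp: "exec prep_prog s ta ma sa" "exec init_prog sa tb mb s1"
    "t1 = ta + tb" "m1 = max ma mb" by (auto elim: exec_SeqE)
  have "exec domset_prog s (ta + (tb + t2)) (max ma (max mb m2)) s2"
    unfolding domset_prog_def by (intro exec.Seq[OF sp(1)] exec.Seq[OF sp(2)] e2(1))
  moreover have "ta + (tb + t2) \<le> 2 * weight n * time_bound N domset_prog"
  proof -
    let ?A = "time_bound N (Seq prep_prog init_prog)" and ?B = "1 + expr_cost ?e + time_bound N ?c"
    \<comment> \<open>There is at least one guess, so the preparation and the final loop test can be
      charged to the rounds; this costs the factor 2.\<close>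
    have le: "x \<le> weight n * x" for x using weight_pos by simp
    have AB: "?A + ?B \<le> time_bound N domset_prog" by (simp add: domset_prog_def)
    have "ta + (tb + t2) \<le> ?A + weight n * ?B + ?B" using e1(2) e2(2) sp(3) by linarith
    also have "\<dots> \<le> weight n * ?A + weight n * ?B + weight n * ?B"
      by (intro add_mono le le_refl)
    also have "\<dots> \<le> 2 * weight n * (?A + ?B)" unfolding distrib_left by simp
    also have "\<dots> \<le> 2 * weight n * time_bound N domset_prog"
      using AB by (rule mult_le_mono2)
    finally show ?thesis .
  qed
  ultimately show ?thesis using e1(3) e2(3,4) sp(4) unfolding accepting_def
    by (intro exI[of _ "ta + (tb + t2)"] exI[of _ "max ma (max mb m2)"] exI[of _ s2]) auto
qed

end


section \<open>Encoded instances\<close>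

text \<open>If neither set lies to the left of the other, there are \<open>y \<le> x\<close> and
  \<open>x' \<le> y'\<close> with \<open>x\<close>, \<open>x'\<close> in \<open>I\<close> and
  \<open>y\<close>, \<open>y'\<close> in \<open>J\<close>. The larger of \<open>x'\<close> and
  \<open>y\<close> lies between two points of each interval or is one of its points.\<close>

lemma intervals_intersect_iff:
  assumes "is_interval I" "is_interval J" "I \<noteq> {}" "J \<noteq> {}"
  shows "I \<inter> J \<noteq> {} \<longleftrightarrow> \<not> left_of I J \<and> \<not> left_of J I"
proof
  assume "I \<inter> J \<noteq> {}"
  then show "\<not> left_of I J \<and> \<not> left_of J I" by (auto simp: left_of_def)
next
  assume "\<not> left_of I J \<and> \<not> left_of J I"
  then obtain x y x' y' where xy: "x \<in> I" "y \<in> J" "y \<le> x" "x' \<in> I" "y' \<in> J" "x' \<le> y'"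
    by (auto simp: left_of_def not_less)
  have I: "z \<in> I" if "x' \<le> z" "z \<le> x" for z using assms(1) xy that unfolding is_interval_1 by blast
  have J: "z \<in> J" if "y \<le> z" "z \<le> y'" for z using assms(2) xy that unfolding is_interval_1 by blast
  consider "x' \<le> y" | "y \<le> x'" by linarith
  then show "I \<inter> J \<noteq> {}"
  proof cases
    case 1
    then show ?thesis using I[of y] xy by blast
  next
    case 2
    then show ?thesis using J[of x'] xy by blast
  qed
qed

lemma nth_concat_triples:
  assumes "j < length ts"
  shows "(concat (map (\<lambda>(v, l, r). [v, l, r]) ts) @ ys) ! (j + (j + j)) = fst (ts ! j)"
    and "(concat (map (\<lambda>(v, l, r). [v, l, r]) ts) @ ys) ! Suc (j + (j + j)) = fst (snd (ts ! j))"
    and "(concat (map (\<lambda>(v, l, r). [v, l, r]) ts) @ ys) ! Suc (Suc (j + (j + j))) = snd (snd (ts ! j))"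
  using assms
proof (induction ts arbitrary: j)
  case (Cons t ts)
  { case 1 then show ?case using Cons.IH(1)[of "j - 1"] by (cases t; cases j) auto }
  { case 2 then show ?case using Cons.IH(2)[of "j - 1"] by (cases t; cases j) auto }
  { case 3 then show ?case using Cons.IH(3)[of "j - 1"] by (cases t; cases j) auto }
qed auto

lemma length_concat_triples:
  "length (concat (map (\<lambda>(v, l, r). [v, l, r]) ts)) = length ts + (length ts + length ts)"
  by (induction ts) auto

lemma less_exp_bit_length: "x < 2 ^ bit_length x"
proof (cases "x = 0")
  case False
  then have "x < 2 * 2 ^ floor_log x" using floor_log_exp2_gt[of x] by simp
  then show ?thesis by (simp add: bit_length_def)
qed (simp add: bit_length_def)

lemma bit_length_exp: "bit_length (2 ^ k) = k + 1"
  by (simp add: bit_length_def)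

lemma less_exp_input_bits: "x \<in> set xs \<Longrightarrow> x < 2 ^ input_bits xs"
proof -
  assume "x \<in> set xs"
  then have "bit_length x \<le> input_bits xs" unfolding input_bits_def by (intro member_le_sum_list) auto
  then have "2 ^ bit_length x \<le> (2 :: nat) ^ input_bits xs" by (intro power_increasing) auto
  then show ?thesis using less_exp_bit_length[of x] by linarith
qed

lemma length_le_input_bits: "length xs \<le> input_bits xs"
  unfolding input_bits_def by (induction xs) (auto simp: bit_length_def)

section \<open>From real intervals to numbered intervals\<close>

locale encoded_instance =
  fixes n :: nat and E f p xs ts and Is :: "real set list"
  assumes rep: "multiple_interval_rep {..<n} E f"
    and xs: "xs = [n, p, length ts] @ concat (map (\<lambda>(v, l, r). [v, l, r]) ts) @ adjacency_matrix n E"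
    and len: "length Is = length ts"
    and triples: "\<forall>(v, l, r)\<in>set ts. v < n \<and> l \<le> r"
    and f: "\<forall>v<n. f v = mset (map snd (filter (\<lambda>(t, I). fst t = v) (zip ts Is)))"
    and order: "\<forall>i<length ts. \<forall>j<length ts.
           snd (snd (ts ! i)) < fst (snd (ts ! j)) \<longleftrightarrow> left_of (Is ! i) (Is ! j)"
begin

abbreviation "owner j \<equiv> fst (ts ! j)"
abbreviation "left j \<equiv> fst (snd (ts ! j))"
abbreviation "right j \<equiv> snd (snd (ts ! j))"

lemma triple: "j < length ts \<Longrightarrow> owner j < n \<and> left j \<le> right j"
  using triples nth_mem[of j ts] by (auto simp: case_prod_beta)

lemma member_f:
  assumes "v < n" shows "I \<in># f v \<longleftrightarrow> (\<exists>j<length ts. owner j = v \<and> Is ! j = I)"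
proof -
  have "I \<in># f v \<longleftrightarrow> (\<exists>t. (t, I) \<in> set (zip ts Is) \<and> fst t = v)"
    using f assms by (auto simp: image_iff)
  also have "\<dots> \<longleftrightarrow> (\<exists>t. \<exists>j<length ts. ts ! j = t \<and> Is ! j = I \<and> fst t = v)"
    using len by (auto simp only: in_set_zip fst_conv snd_conv)
  also have "\<dots> \<longleftrightarrow> (\<exists>j<length ts. owner j = v \<and> Is ! j = I)" by blast
  finally show ?thesis .
qed

lemma size_f:
  assumes "v < n" shows "size (f v) = card {j. j < length ts \<and> owner j = v}"
proof -
  have "size (f v) = length (filter (\<lambda>(t, I). fst t = v) (zip ts Is))"
    using f assms by (metis length_map size_mset)
  also have "\<dots> = card {j. j < length (zip ts Is) \<and> fst (fst (zip ts Is ! j)) = v}"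
    by (simp add: length_filter_conv_card case_prod_beta)
  also have "{j. j < length (zip ts Is) \<and> fst (fst (zip ts Is ! j)) = v} = {j. j < length ts \<and> owner j = v}"
    using len by auto
  finally show ?thesis .
qed

sublocale interval_system n "length ts" owner left right
proof
  fix v assume "v < n"
  then have "f v \<noteq> {#}" using rep by (simp add: multiple_interval_rep_def)
  then obtain I where "I \<in># f v" by blast
  then show "\<exists>j<length ts. owner j = v" using member_f[OF \<open>v < n\<close>] by blast
qed (use triple in auto)

text \<open>The encoding records only which intervals lie to the left of which others, and for
  nonempty intervals this determines all intersections.\<close>

lemma intersect_iff:
  assumes "i < length ts" "j < length ts"
  shows "Is ! i \<inter> Is ! j \<noteq> {} \<longleftrightarrow> hit i j"
proof -
  have "is_interval (Is ! i) \<and> Is ! i \<noteq> {}" if "i < length ts" for i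
    using rep triple[OF that] member_f[of "owner i" "Is ! i"] that
    unfolding multiple_interval_rep_def by blast
  then have "Is ! i \<inter> Is ! j \<noteq> {} \<longleftrightarrow> \<not> left_of (Is ! i) (Is ! j) \<and> \<not> left_of (Is ! j) (Is ! i)"
    using assms by (intro intervals_intersect_iff) auto
  also have "\<dots> \<longleftrightarrow> \<not> right i < left j \<and> \<not> right j < left i" using order assms by blast
  finally show ?thesis unfolding hit_def not_less by blast
qed

lemma edge_iff:
  assumes "u < n" "v < n" "u \<noteq> v"
  shows "{u, v} \<in> E \<longleftrightarrow>
    (\<exists>i j. i < length ts \<and> j < length ts \<and> owner i = u \<and> owner j = v \<and> hit i j)"
proof -
  have "{u, v} \<in> E \<longleftrightarrow> (\<exists>I\<in>#f u. \<exists>J\<in>#f v. I \<inter> J \<noteq> {})"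
    using rep assms by (simp add: multiple_interval_rep_def)
  also have "\<dots> \<longleftrightarrow> (\<exists>i j. i < length ts \<and> j < length ts \<and> owner i = u \<and> owner j = v \<and> Is ! i \<inter> Is ! j \<noteq> {})"
    unfolding Bex_def member_f[OF assms(1)] member_f[OF assms(2)] by blast
  finally show ?thesis by (simp add: intersect_iff cong: conj_cong)
qed

lemma dominating_set_iff: "dominating_set {..<n} E D \<longleftrightarrow> dominates D"
proof -
  have "(\<exists>u\<in>D. {u, v} \<in> E) \<longleftrightarrow>
    (\<exists>i j. i < length ts \<and> j < length ts \<and> owner i \<in> D \<and> owner j = v \<and> hit i j)"
    if "D \<subseteq> {..<n}" "v < n" "v \<notin> D" for v
  proof -
    have "{u, v} \<in> E \<longleftrightarrow> (\<exists>i j. i < length ts \<and> j < length ts \<and> owner i = u \<and> owner j = v \<and> hit i j)"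
      if "u \<in> D" for u
      by (rule edge_iff) (use that \<open>D \<subseteq> {..<n}\<close> \<open>v < n\<close> \<open>v \<notin> D\<close> in auto)
    then show ?thesis by blast
  qed
  then show ?thesis unfolding dominating_set_def dominates_def by auto
qed

lemma sum_size: "(\<Sum>v<n. size (f v)) = length ts"
  using sum_cnt size_f by (simp add: cnt_def)

lemma input_nth:
  "xs ! 0 = n" "xs ! 1 = p" "xs ! 2 = length ts"
  "j < length ts \<Longrightarrow> xs ! (3 + (j + (j + j))) = owner j"
  "j < length ts \<Longrightarrow> xs ! (4 + (j + (j + j))) = left j"
  "j < length ts \<Longrightarrow> xs ! (5 + (j + (j + j))) = right j"
  using nth_concat_triples[of j ts "adjacency_matrix n E"] by (simp_all add: xs eval_nat_numeral)

lemma length_input: "3 + (length ts + (length ts + length ts)) \<le> length xs"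
  by (simp add: xs length_concat_triples)

text \<open>Both \<open>n\<close> and the number of intervals are input numbers below
  \<open>2 ^ input_bits xs\<close>, so twice this power bounds their sum, while its bit length stays
  linear in the input.\<close>

sublocale domset_run n "length ts" owner left right p "length xs" "2 * 2 ^ input_bits xs"
proof
  have "n \<in> set xs" "length ts \<in> set xs" by (auto simp: xs)
  then show "n + length ts \<le> 2 * 2 ^ input_bits xs"
    using less_exp_input_bits[of n xs] less_exp_input_bits[of "length ts" xs] by linarith
  fix j assume j: "j < length ts"
  then have "right j \<in> set xs" using input_nth(6)[OF j] length_input nth_mem[of "5 + (j + (j + j))" xs] by auto
  then show "right j < 2 * 2 ^ input_bits xs" using less_exp_input_bits[of "right j" xs] by linarith
qed (use length_input in auto)

lemma good_initial: "good (initial_state xs)"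
proof -
  have nth: "initial_state xs 0 i = xs ! i" if "i < length xs" for i
    using that by (simp add: initial_state_def)
  have three: "0 < length xs" "1 < length xs" "2 < length xs" using length_input by linarith+
  have "a < 13 \<and> i < length xs \<and> initial_state xs a i \<le> 2 * 2 ^ input_bits xs"
    if "initial_state xs a i \<noteq> 0" for a i
    using that less_exp_input_bits[of "xs ! i" xs] by (auto simp: initial_state_def split: if_splits)
  moreover have "initial_state xs 0 (3 + (j + (j + j))) = owner j \<and>
    initial_state xs 0 (4 + (j + (j + j))) = left j \<and> initial_state xs 0 (5 + (j + (j + j))) = right j"
    if "j < length ts" for j
    using length_input input_nth(4-6)[OF that] that by (subst (1 2 3) nth) auto
  moreover have "initial_state xs 0 0 = n" "initial_state xs 0 1 = p" "initial_state xs 0 2 = length ts"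
    using nth[of 0] nth[of 1] nth[of 2] input_nth(1-3) three by simp_all
  ultimately show ?thesis unfolding good_def by blast
qed

lemma run_on_instance:
  "\<exists>t m s. exec domset_prog (initial_state xs) t m s \<and>
     (accepting s \<longleftrightarrow> (\<exists>D. dominating_set {..<n} E D \<and> card D = p)) \<and>
     t \<le> 2 * weight n * time_bound (length ts) domset_prog \<and> m \<le> 221 * input_bits xs ^ 2"
proof -
  let ?B = "input_bits xs"
  have "1 \<le> ?B" using length_input length_le_input_bits[of xs] by linarith
  have "bit_length (2 * 2 ^ ?B) = ?B + 2" using bit_length_exp[of "Suc ?B"] by simp
  then have "13 * length xs * (13 + length xs + bit_length (2 * 2 ^ ?B)) \<le> 13 * ?B * (15 + 2 * ?B)"
    using length_le_input_bits[of xs] by (intro mult_le_mono) auto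
  \<comment> \<open>Since \<open>?B\<close> is at least 1, \<open>15 + 2 * ?B\<close> is at most
    \<open>17 * ?B\<close>; the constant of the result is \<open>221 = 13 * 17\<close>.\<close>
  also have "\<dots> \<le> 13 * ?B * (17 * ?B)" using \<open>1 \<le> ?B\<close> by (intro mult_le_mono) auto
  finally have "13 * length xs * (13 + length xs + bit_length (2 * 2 ^ ?B)) \<le> 221 * ?B ^ 2"
    by (simp add: power2_eq_square)
  moreover have "initial_state xs 2 v = 0" "initial_state xs 1 0 = 0" "initial_state xs 6 0 = 0" for v
    by (simp_all add: initial_state_def)
  ultimately show ?thesis
    using exec_domset[OF good_initial] unfolding dominating_set_iff by (meson le_trans)
qed

end

theorem theorem6:
  shows "\<exists>(c :: prog) (C :: nat) (d :: nat) (C' :: nat) (d' :: nat).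
    \<forall>(n :: nat) (E :: nat set set) (f :: nat \<Rightarrow> real set multiset) (k :: nat) (p :: nat) (xs :: nat list).
      simple_graph {..<n} E \<and>
      multiple_interval_rep {..<n} E f \<and>
      (\<Sum>v<n. size (f v)) \<le> n + k \<and>
      0 < p \<and>
      encodes_instance n E f p xs \<longrightarrow>
      (\<exists>t m s. exec c (initial_state xs) t m s \<and>
         (accepting s \<longleftrightarrow> (\<exists>D. dominating_set {..<n} E D \<and> card D = p)) \<and>
         t \<le> C * 3 ^ k * max 1 n ^ d \<and>
         m \<le> C' * input_bits xs ^ d')"
proof -
  obtain C d where time: "\<And>Z. time_bound Z domset_prog \<le> C * (Z + 1) ^ d"
    using time_bound_poly by blast
  obtain K where K: "\<And>j::nat. (j + 1) * j ^ d \<le> K * 3 ^ j" using poly_le_exp by blast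
  \<comment> \<open>The summand 1 makes \<open>C0\<close> positive, which settles the graph without
    vertices.\<close>
  define C0 where "C0 = 3 * K * 2 ^ d + 1"
  show ?thesis
  proof (rule exI[of _ domset_prog], rule exI[of _ "2 * C * C0"], rule exI[of _ d],
      rule exI[of _ 221], rule exI[of _ 2], intro allI impI)
    fix n E f k p xs
    assume a: "simple_graph {..<n} E \<and> multiple_interval_rep {..<n} E f \<and>
      (\<Sum>v<n. size (f v)) \<le> n + k \<and> 0 < p \<and> encodes_instance n E f p xs"
    then obtain ts Is where "encoded_instance n E f p xs ts Is"
      unfolding encodes_instance_def encodes_rep_def encoded_instance_def by blast
    then interpret encoded_instance n E f p xs ts Is .
    obtain t m s where run: "exec domset_prog (initial_state xs) t m s"
      "accepting s \<longleftrightarrow> (\<exists>D. dominating_set {..<n} E D \<and> card D = p)"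
      "t \<le> 2 * weight n * time_bound (length ts) domset_prog" "m \<le> 221 * input_bits xs ^ 2"
      using run_on_instance by blast
    have W: "weight n * (length ts + 1) ^ d \<le> C0 * 3 ^ k * max 1 n ^ d"
    proof (cases "n = 0")
      case True
      then have ts: "length ts = 0" using triple[of 0] by (cases ts) auto
      have weight: "weight n = 1" unfolding True by (rule weight_0)
      have "weight n * (length ts + 1) ^ d = 1" by (subst weight) (simp add: ts)
      also have "1 \<le> C0 * 3 ^ k * max 1 n ^ d" by (simp add: C0_def True Suc_le_eq)
      finally show ?thesis .
    next
      case False
      \<comment> \<open>The list contains each interval once, so its length is the sum bounded by
        \<open>n + k\<close>.\<close>
      have "length ts - n \<le> k" using a sum_size by auto
      then have "(3::nat) ^ (length ts - n) \<le> 3 ^ k" by (intro power_increasing) auto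
      then have "3 * K * 2 ^ d * 3 ^ (length ts - n) * n ^ d \<le> C0 * 3 ^ k * max 1 n ^ d"
        by (intro mult_le_mono power_mono) (auto simp: C0_def)
      then show ?thesis using weight_mult_poly_le[OF K] False by (meson le_trans neq0_conv)
    qed
    have "t \<le> 2 * weight n * (C * (length ts + 1) ^ d)"
      using run(3) mult_le_mono2[OF time] le_trans by blast
    also have "\<dots> = 2 * C * (weight n * (length ts + 1) ^ d)" by simp
    also have "\<dots> \<le> 2 * C * (C0 * 3 ^ k * max 1 n ^ d)" using W by (rule mult_le_mono2)
    finally have "t \<le> 2 * C * C0 * 3 ^ k * max 1 n ^ d" by (simp add: mult.assoc)
    then show "\<exists>t m s. exec domset_prog (initial_state xs) t m s \<and>
         (accepting s \<longleftrightarrow> (\<exists>D. dominating_set {..<n} E D \<and> card D = p)) \<and>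
         t \<le> 2 * C * C0 * 3 ^ k * max 1 n ^ d \<and> m \<le> 221 * input_bits xs ^ 2"
      using run by blast
  qed
qed

end
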